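(* Let $(B_0,B_1)$ be an interpolation couple of complex Banach spaces, let $\theta\in(0,1)$ and let $p\in(1,+\infty)$. If the dual norm on $B_0^*$ is rotund, then the dual $B_{\theta,p}^*$ of the real interpolation space $B_{\theta,p}=(B_0,B_1)_{\theta,p}$ admits an equivalent rotund dual norm.
   Context: An interpolation couple $(B_0,B_1)$ is a pair of complex Banach spaces continuously embedded in a common Hausdorff topological vector space. Real interpolation space: for $a\in B_0+B_1$ and $t>0$ let $K(t,a)=\inf\{\|a_0\|_{B_0}+t\|a_1\|_{B_1}: a=a_0+a_1,\ a_j\in B_j\}$. Then $B_{\theta,p}=\{a\in B_0+B_1: \|a\|_{B_{\theta,p}}=\left[\int_0^\infty (t^{-\theta}K(t,a))^p\frac{dt}{t}\right]^{1/p}<+\infty\}$, a Banach space with this norm. A norm $\|\cdot\|$ on a Banach space $X$ is rotund if $\|\frac{x+y}{2}\|<1$ whenever $\|x\|=\|y\|=1$ and $x\neq y$. An equivalent dual norm on $X^*$ is a norm on $X^*$ that is the dual norm of some equivalent norm on $X$. *)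

theory Defs
  imports "HOL-Analysis.Analysis" "HOL-Library.Function_Algebras"
begin

text \<open>
  Complex vector spaces are given by a type together with a scalar multiplication
  \<open>s :: complex \<Rightarrow> 'v \<Rightarrow> 'v\<close>.  A normed space is a pair \<open>X\<close>, \<open>N\<close> of a linear subspace and a
  function that is a norm on \<open>X\<close>; the values of \<open>N\<close> outside \<open>X\<close> are irrelevant.  This allows
  several spaces with different norms inside one ambient space.
\<close>

definition norm_on :: "(complex \<Rightarrow> 'v \<Rightarrow> 'v) \<Rightarrow> 'v::ab_group_add set \<Rightarrow> ('v \<Rightarrow> real) \<Rightarrow> bool" where
  "norm_on s X N \<longleftrightarrow>
     module.subspace s X \<and>
     (\<forall>x\<in>X. 0 \<le> N x) \<and>
     (\<forall>x\<in>X. N x = 0 \<longleftrightarrow> x = 0) \<and>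
     (\<forall>x\<in>X. \<forall>y\<in>X. N (x + y) \<le> N x + N y) \<and>
     (\<forall>c. \<forall>x\<in>X. N (s c x) = cmod c * N x)"

definition banach_on :: "(complex \<Rightarrow> 'v \<Rightarrow> 'v) \<Rightarrow> 'v::ab_group_add set \<Rightarrow> ('v \<Rightarrow> real) \<Rightarrow> bool" where
  "banach_on s X N \<longleftrightarrow>
     norm_on s X N \<and>
     (\<forall>u. (\<forall>n. u n \<in> X) \<and> (\<forall>e>0. \<exists>M. \<forall>m\<ge>M. \<forall>n\<ge>M. N (u m - u n) < e)
        \<longrightarrow> (\<exists>l\<in>X. (\<lambda>n. N (u n - l)) \<longlonglongrightarrow> 0))"

definition equivalent_norm ::
  "(complex \<Rightarrow> 'v \<Rightarrow> 'v) \<Rightarrow> 'v::ab_group_add set \<Rightarrow> ('v \<Rightarrow> real) \<Rightarrow> ('v \<Rightarrow> real) \<Rightarrow> bool" where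
  "equivalent_norm s X N N' \<longleftrightarrow>
     norm_on s X N' \<and> (\<exists>c>0. \<exists>C>0. \<forall>x\<in>X. c * N x \<le> N' x \<and> N' x \<le> C * N x)"

definition rotund :: "(complex \<Rightarrow> 'v \<Rightarrow> 'v) \<Rightarrow> 'v::ab_group_add set \<Rightarrow> ('v \<Rightarrow> real) \<Rightarrow> bool" where
  "rotund s X N \<longleftrightarrow>
     (\<forall>x\<in>X. \<forall>y\<in>X. N x = 1 \<and> N y = 1 \<and> x \<noteq> y \<longrightarrow> N (s (1/2) (x + y)) < 1)"

text \<open>
  Elements of the dual of \<open>X\<close> are represented by functions on the ambient type that vanish
  outside \<open>X\<close>, so that equality of functions is equality of functionals on \<open>X\<close>.
\<close>

definition dual :: "(complex \<Rightarrow> 'v \<Rightarrow> 'v) \<Rightarrow> 'v::ab_group_add set \<Rightarrow> ('v \<Rightarrow> real) \<Rightarrow> ('v \<Rightarrow> complex) set" where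
  "dual s X N =
     {f. (\<forall>x\<in>X. \<forall>y\<in>X. f (x + y) = f x + f y) \<and>
         (\<forall>c. \<forall>x\<in>X. f (s c x) = c * f x) \<and>
         (\<exists>C. \<forall>x\<in>X. cmod (f x) \<le> C * N x) \<and>
         (\<forall>x. x \<notin> X \<longrightarrow> f x = 0)}"

definition dual_norm :: "'v set \<Rightarrow> ('v \<Rightarrow> real) \<Rightarrow> ('v \<Rightarrow> complex) \<Rightarrow> real" where
  "dual_norm X N f = (SUP x\<in>{x\<in>X. N x \<le> 1}. cmod (f x))"

definition scale_fun :: "complex \<Rightarrow> ('v \<Rightarrow> complex) \<Rightarrow> ('v \<Rightarrow> complex)" where
  "scale_fun c f = (\<lambda>x. c * f x)"

definition equivalent_dual_norm ::
  "(complex \<Rightarrow> 'v \<Rightarrow> 'v) \<Rightarrow> 'v::ab_group_add set \<Rightarrow> ('v \<Rightarrow> real) \<Rightarrow> (('v \<Rightarrow> complex) \<Rightarrow> real) \<Rightarrow> bool" where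
  "equivalent_dual_norm s X N M \<longleftrightarrow>
     (\<exists>N'. equivalent_norm s X N N' \<and> (\<forall>f\<in>dual s X N. M f = dual_norm X N' f))"

text \<open>
  Together with the classes \<open>topological_ab_group_add\<close> and \<open>t2_space\<close>, this says that the
  ambient type is a complex Hausdorff topological vector space.
\<close>

definition complex_tvs :: "(complex \<Rightarrow> 'v \<Rightarrow> 'v::{topological_ab_group_add, t2_space}) \<Rightarrow> bool" where
  "complex_tvs s \<longleftrightarrow> vector_space s \<and> continuous_on UNIV (\<lambda>(c, x). s c x)"

text \<open>Continuity of the inclusion of \<open>X\<close>, with the norm topology of \<open>N\<close>, into the ambient space.\<close>

definition continuously_embedded :: "'v::{topological_ab_group_add, t2_space} set \<Rightarrow> ('v \<Rightarrow> real) \<Rightarrow> bool" where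
  "continuously_embedded X N \<longleftrightarrow>
     (\<forall>x\<in>X. \<forall>U. open U \<and> x \<in> U \<longrightarrow> (\<exists>e>0. \<forall>y\<in>X. N (y - x) < e \<longrightarrow> y \<in> U))"

definition interpolation_couple ::
  "(complex \<Rightarrow> 'v \<Rightarrow> 'v) \<Rightarrow> 'v::{topological_ab_group_add, t2_space} set \<Rightarrow> ('v \<Rightarrow> real) \<Rightarrow> 'v set \<Rightarrow> ('v \<Rightarrow> real) \<Rightarrow> bool" where
  "interpolation_couple s B0 N0 B1 N1 \<longleftrightarrow>
     complex_tvs s \<and>
     banach_on s B0 N0 \<and> continuously_embedded B0 N0 \<and>
     banach_on s B1 N1 \<and> continuously_embedded B1 N1"

definition K_functional ::
  "'v::ab_group_add set \<Rightarrow> ('v \<Rightarrow> real) \<Rightarrow> 'v set \<Rightarrow> ('v \<Rightarrow> real) \<Rightarrow> real \<Rightarrow> 'v \<Rightarrow> real" where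
  "K_functional B0 N0 B1 N1 t a =
     Inf {N0 a0 + t * N1 a1 | a0 a1. a0 \<in> B0 \<and> a1 \<in> B1 \<and> a = a0 + a1}"

definition interp_integral ::
  "'v::ab_group_add set \<Rightarrow> ('v \<Rightarrow> real) \<Rightarrow> 'v set \<Rightarrow> ('v \<Rightarrow> real) \<Rightarrow> real \<Rightarrow> real \<Rightarrow> 'v \<Rightarrow> ennreal" where
  "interp_integral B0 N0 B1 N1 \<theta> p a =
     (\<integral>\<^sup>+t\<in>{0<..}. ennreal ((t powr (-\<theta>) * K_functional B0 N0 B1 N1 t a) powr p / t) \<partial>lborel)"

definition interp_space ::
  "'v::ab_group_add set \<Rightarrow> ('v \<Rightarrow> real) \<Rightarrow> 'v set \<Rightarrow> ('v \<Rightarrow> real) \<Rightarrow> real \<Rightarrow> real \<Rightarrow> 'v set" where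
  "interp_space B0 N0 B1 N1 \<theta> p =
     {a. (\<exists>a0\<in>B0. \<exists>a1\<in>B1. a = a0 + a1) \<and> interp_integral B0 N0 B1 N1 \<theta> p a < \<infinity>}"

definition interp_norm ::
  "'v::ab_group_add set \<Rightarrow> ('v \<Rightarrow> real) \<Rightarrow> 'v set \<Rightarrow> ('v \<Rightarrow> real) \<Rightarrow> real \<Rightarrow> real \<Rightarrow> 'v \<Rightarrow> real" where
  "interp_norm B0 N0 B1 N1 \<theta> p a = enn2real (interp_integral B0 N0 B1 N1 \<theta> p a) powr (1 / p)"

end

theory Submission
  imports Defs
begin

text \<open>
  The proof is a discrete version of the description of \<open>B\<close> by the \<open>K\<close>-functional.  Let \<open>Y\<close> be the
  \<open>l\<^sup>p\<close>-sum over \<open>m \<in> \<int>\<close> of \<open>B0\<close> with the norm \<open>2\<^bsup>-m\<theta>\<^esup> N0\<close> and \<open>B1\<close> with the norm \<open>2\<^bsup>m(1-\<theta>)\<^esup> N1\<close>.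
  Up to equivalence of norms, \<open>B\<close> is the quotient of the subspace of those families \<open>z\<close> in \<open>Y\<close> for which
  \<open>z (m, False) + z (m, True)\<close> does not depend on \<open>m\<close>.  By Hahn-Banach, two functionals \<open>f\<close>, \<open>g\<close> on
  \<open>B\<close> lift to functionals on \<open>Y\<close> of the same norms; if \<open>\<parallel>f\<parallel> = \<parallel>g\<parallel> = \<parallel>(f + g) / 2\<parallel>\<close>, then strict
  convexity of \<open>l\<^sup>q\<close> and rotundity of the dual of \<open>B0\<close> show that the two lifts have the same components
  on all copies of \<open>B0\<close>.  These components already determine the functionals on \<open>B\<close>, since the copies
  of \<open>B0\<close> and \<open>B1\<close> at the same \<open>m\<close> are linked along \<open>B0 \<inter> B1\<close>.
\<close>

section \<open>The Hahn-Banach theorem for sublinear functionals\<close>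

text \<open>The hypothesis concerns functionals on \<open>B0\<close> alone, while the integral that
  defines the norm of \<open>B\<close> gives no direct access to functionals. Passing to an l^p-sum
  repairs this: a functional of norm at most 1 on the quotient pulls back to the subspace, extends
  to the sum and splits into functionals on the single copies, whose norms have an l^q-sum of at
  most 1, where 1/p + 1/q = 1. The functional (f + g) / 2 is lifted by the midpoint of the two lifts
  and not by an extension of its own, so that its components are midpoints as well. Suprema need not
  be attained, so norm 1 of the midpoint is exploited through vectors that nearly attain it. Since
  the new norm is put on \<open>B\<close> itself, the resulting norm on the dual is a dual norm by
  construction. Nothing forces the two lifts to agree on the copies of \<open>B1\<close>; what saves
  the argument is that the weight of \<open>B1\<close> grows like 2 powr (m * (1 - \<theta>)), so
  the \<open>B1\<close> parts of a fixed family become small as m grows.\<close>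

definition sublinear_on :: "(real \<Rightarrow> 'a \<Rightarrow> 'a) \<Rightarrow> 'a::ab_group_add set \<Rightarrow> ('a \<Rightarrow> real) \<Rightarrow> bool" where
  "sublinear_on scl Y Q \<longleftrightarrow>
     (\<forall>x\<in>Y. \<forall>y\<in>Y. Q (x + y) \<le> Q x + Q y) \<and> (\<forall>r>0. \<forall>x\<in>Y. Q (scl r x) \<le> r * Q x)"

lemma sublinear_onD:
  assumes "sublinear_on scl Y Q"
  shows "\<And>x y. x \<in> Y \<Longrightarrow> y \<in> Y \<Longrightarrow> Q (x + y) \<le> Q x + Q y"
    "\<And>r x. r > 0 \<Longrightarrow> x \<in> Y \<Longrightarrow> Q (scl r x) \<le> r * Q x"
  using assms unfolding sublinear_on_def by auto

context vector_space begin

lemma subspace_closed: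
  assumes "subspace Y"
  shows "0 \<in> Y" "\<And>x y. x \<in> Y \<Longrightarrow> y \<in> Y \<Longrightarrow> x + y \<in> Y"
    "\<And>x y. x \<in> Y \<Longrightarrow> y \<in> Y \<Longrightarrow> x - y \<in> Y" "\<And>x. x \<in> Y \<Longrightarrow> - x \<in> Y"
    "\<And>c x. x \<in> Y \<Longrightarrow> scale c x \<in> Y"
  using assms subspace_0 subspace_add subspace_diff subspace_neg subspace_scale by auto

end

lemma sublinear_on_zero:
  assumes "vector_space scl" "module.subspace scl Y" "sublinear_on scl Y Q"
  shows "Q 0 = 0"
proof -
  interpret vector_space scl by fact
  have "0 \<in> Y" using assms(2) subspace_0 by blast
  then have "Q (scl r 0) \<le> r * Q 0" if "r > 0" for r
    using assms(3) that unfolding sublinear_on_def by blast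
  \<comment> \<open>The factor 2 gives \<open>0 \<le> Q 0\<close>, the factor 1/2 the
    reverse.\<close>
  from this[of 2] this[of "1/2"] show ?thesis by simp
qed

lemma sublinear_on_neg:
  assumes "vector_space scl" "module.subspace scl Y" "sublinear_on scl Y Q" "x \<in> Y"
  shows "- Q (- x) \<le> Q x"
proof -
  interpret vector_space scl by fact
  have "- x \<in> Y" using assms subspace_neg by blast
  then have "Q (x + - x) \<le> Q x + Q (- x)" using assms unfolding sublinear_on_def by blast
  with sublinear_on_zero[OF assms(1-3)] show ?thesis by simp
qed

text \<open>Subtracting \<open>v\<close> along a cone \<open>T\<close> produces both the sublinear functional that forces an
  extension to agree with a given one and the one that shows that minimal functionals are
  additive.\<close>

lemma sublinear_on_cone:
  assumes vs: "vector_space scl" and Y: "module.subspace scl Y" and Q: "sublinear_on scl Y Q"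
    and T: "T \<subseteq> Y" "0 \<in> T" "\<And>x y. x \<in> T \<Longrightarrow> y \<in> T \<Longrightarrow> x + y \<in> T"
      "\<And>r x. r > 0 \<Longrightarrow> x \<in> T \<Longrightarrow> scl r x \<in> T"
    and v: "\<And>x y. x \<in> T \<Longrightarrow> y \<in> T \<Longrightarrow> v x + v y \<le> v (x + y)"
      "\<And>r x. r > 0 \<Longrightarrow> x \<in> T \<Longrightarrow> v (scl r x) = r * v x" "\<And>x. x \<in> T \<Longrightarrow> v x \<le> Q x"
  obtains R where "sublinear_on scl Y R" "\<And>x. x \<in> Y \<Longrightarrow> R x \<le> Q x"
    "\<And>x t. x \<in> Y \<Longrightarrow> t \<in> T \<Longrightarrow> R x \<le> Q (x + t) - v t"
proof -
  interpret vector_space scl by fact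
  note cl = subspace_closed[OF Y]
  \<comment> \<open>The infimum is finite because
    \<open>v t \<le> Q t \<le> Q (x + t) + Q (- x)\<close>; the choice \<open>t = 0\<close> gives
    \<open>R \<le> Q\<close>.\<close>
  define R where "R x = (INF t\<in>T. Q (x + t) - v t)" for x
  have bdd: "bdd_below ((\<lambda>t. Q (x + t) - v t) ` T)" if x: "x \<in> Y" for x
  proof (rule bdd_belowI2)
    fix t assume t: "t \<in> T"
    have "Q (x + t + - x) \<le> Q (x + t) + Q (- x)"
      using x t T(1) by (intro sublinear_onD(1)[OF Q] cl) auto
    with v(3)[OF t] show "- Q (- x) \<le> Q (x + t) - v t" by simp
  qed
  have lower: "R x \<le> Q (x + t) - v t" if "x \<in> Y" "t \<in> T" for x t
    unfolding R_def using bdd that by (intro cINF_lower) auto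
  have greatest: "c \<le> R x" if "\<And>t. t \<in> T \<Longrightarrow> c \<le> Q (x + t) - v t" for c x
    unfolding R_def using T(2) that by (intro cINF_greatest) auto
  have v0: "v 0 = 0" using v(2)[of 2 0] T(2) by simp
  have "sublinear_on scl Y R"
    unfolding sublinear_on_def
  proof (intro conjI ballI allI impI)
    fix x y assume x: "x \<in> Y" and y: "y \<in> Y"
    have *: "R (x + y) \<le> (Q (x + t) - v t) + (Q (y + t') - v t')" if "t \<in> T" "t' \<in> T" for t t'
    proof -
      have "R (x + y) \<le> Q (x + y + (t + t')) - v (t + t')"
        using x y T(3) that by (intro lower cl) auto
      moreover have "Q ((x + t) + (y + t')) \<le> Q (x + t) + Q (y + t')"
        using x y T(1) that by (intro sublinear_onD(1)[OF Q] cl) auto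
      ultimately show ?thesis using v(1)[OF that] by (simp add: algebra_simps)
    qed
    have "R (x + y) - (Q (x + t) - v t) \<le> R y" if "t \<in> T" for t
      using *[OF that] by (intro greatest) (simp add: algebra_simps)
    then have "R (x + y) - R y \<le> R x"
      by (intro greatest) (simp add: algebra_simps)
    then show "R (x + y) \<le> R x + R y" by simp
  next
    fix r :: real and x assume r: "r > 0" and x: "x \<in> Y"
    have "R (scl r x) / r \<le> R x"
    proof (rule greatest)
      fix t assume t: "t \<in> T"
      have "R (scl r x) \<le> Q (scl r x + scl r t) - v (scl r t)"
        using T(4) r x t by (intro lower cl) auto
      also have "scl r x + scl r t = scl r (x + t)" by (simp add: scale_right_distrib)
      also have "Q (scl r (x + t)) \<le> r * Q (x + t)"
        using r x t T(1) by (intro sublinear_onD(2)[OF Q] cl) auto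
      finally show "R (scl r x) / r \<le> Q (x + t) - v t"
        using r v(2)[OF r t] by (simp add: field_simps)
    qed
    then show "R (scl r x) \<le> r * R x" using r by (simp add: field_simps)
  qed
  moreover have "R x \<le> Q x" if "x \<in> Y" for x
    using lower[OF that T(2)] v0 by simp
  ultimately show ?thesis using lower by (rule that)
qed

text \<open>Zorn's lemma: the pointwise infimum of a chain is again sublinear, and it is finite
  because all members share the lower bound \<open>- P (- x)\<close>.\<close>

lemma minimal_sublinear_on:
  assumes vs: "vector_space scl" and Y: "module.subspace scl Y" and P: "sublinear_on scl Y P"
  obtains Q where "sublinear_on scl Y Q" "\<And>x. x \<in> Y \<Longrightarrow> Q x \<le> P x"
    "\<And>R x. sublinear_on scl Y R \<Longrightarrow> (\<And>y. y \<in> Y \<Longrightarrow> R y \<le> Q y) \<Longrightarrow> x \<in> Y \<Longrightarrow> R x = Q x"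
proof -
  interpret vector_space scl by fact
  note cl = subspace_closed[OF Y]
  \<comment> \<open>Fixing the value 0 outside \<open>Y\<close> lets functions be compared at all
    points, which makes the order antisymmetric.\<close>
  let ?z = "\<lambda>Q x. if x \<in> Y then Q x else (0::real)"
  define A where "A = {Q. sublinear_on scl Y Q \<and> (\<forall>x\<in>Y. Q x \<le> P x) \<and> (\<forall>x. x \<notin> Y \<longrightarrow> Q x = 0)}"
  have sub_z: "sublinear_on scl Y (?z Q)" if "sublinear_on scl Y Q" for Q
    using that cl unfolding sublinear_on_def by simp
  \<comment> \<open>The order is reversed, so that a maximal element for \<open>le\<close> is a
    minimal functional.\<close>
  define le where "le Q R \<longleftrightarrow> (\<forall>x. R x \<le> Q x)" for Q R :: "'a \<Rightarrow> real"
  have PA: "?z P \<in> A" using sub_z[OF P] by (simp add: A_def)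
  have "\<exists>m\<in>A. \<forall>a\<in>A. le m a \<longrightarrow> a = m"
  proof (rule predicate_Zorn)
    show "partial_order_on A (relation_of le A)"
      by (rule partial_order_on_relation_ofI)
        (auto simp: le_def fun_eq_iff intro: order_trans antisym)
  next
    fix C assume C: "C \<in> Chains (relation_of le A)"
    then have CA: "C \<subseteq> A" and ch: "\<And>Q R. Q \<in> C \<Longrightarrow> R \<in> C \<Longrightarrow> le Q R \<or> le R Q"
      by (auto simp: Chains_def relation_of_def)
    show "\<exists>u\<in>A. \<forall>a\<in>C. le a u"
    proof (cases "C = {}")
      case True then show ?thesis using PA by auto
    next
      case False
      define R where "R x = (INF Q\<in>C. Q x)" for x
      have bdd: "bdd_below ((\<lambda>Q. Q x) ` C)" for x
      proof (rule bdd_belowI2)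
        fix Q assume "Q \<in> C"
        then have Q: "Q \<in> A" using CA by blast
        show "(if x \<in> Y then - P (- x) else 0) \<le> Q x"
        proof (cases "x \<in> Y")
          case True
          then have "Q (- x) \<le> P (- x)" using Q cl by (auto simp: A_def)
          with sublinear_on_neg[OF vs Y _ True, of Q] Q True show ?thesis by (auto simp: A_def)
        qed (use Q in \<open>auto simp: A_def\<close>)
      qed
      have lower: "R x \<le> Q x" if "Q \<in> C" for Q x
        unfolding R_def using bdd that by (intro cINF_lower) auto
      have greatest: "c \<le> R x" if "\<And>Q. Q \<in> C \<Longrightarrow> c \<le> Q x" for c x
        unfolding R_def using False that by (intro cINF_greatest) auto
      have "sublinear_on scl Y R"
        unfolding sublinear_on_def
      proof (intro conjI ballI allI impI)
        fix x y assume x: "x \<in> Y" and y: "y \<in> Y"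
        have *: "R (x + y) \<le> Q x + Q' y" if q: "Q \<in> C" "Q' \<in> C" for Q Q'
        proof -
          \<comment> \<open>Two members of a chain are comparable, so the smaller one serves at both
            points.\<close>
          obtain S where S: "S \<in> C" "S x \<le> Q x" "S y \<le> Q' y"
            using ch[OF q] q unfolding le_def by blast
          have "S (x + y) \<le> S x + S y"
            using S(1) CA x y unfolding A_def sublinear_on_def by blast
          with S lower[OF S(1), of "x + y"] show ?thesis by simp
        qed
        have "R (x + y) - Q x \<le> R y" if "Q \<in> C" for Q
          using *[OF that] by (intro greatest) (simp add: algebra_simps)
        then have "R (x + y) - R y \<le> R x"
          by (intro greatest) (simp add: algebra_simps)
        then show "R (x + y) \<le> R x + R y" by simp
      next
        fix r :: real and x assume r: "r > 0" and x: "x \<in> Y"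
        have "R (scl r x) / r \<le> R x"
        proof (rule greatest)
          fix Q assume Q: "Q \<in> C"
          then have "Q (scl r x) \<le> r * Q x" using CA r x unfolding A_def sublinear_on_def by blast
          with lower[OF Q, of "scl r x"] r show "R (scl r x) / r \<le> Q x" by (simp add: field_simps)
        qed
        then show "R (scl r x) \<le> r * R x" using r by (simp add: field_simps)
      qed
      moreover obtain Q where Q: "Q \<in> C" using False by blast
      then have "R x \<le> P x" if "x \<in> Y" for x
        using lower[OF Q, of x] CA that by (force simp: A_def)
      moreover have "R x = 0" if "x \<notin> Y" for x
      proof -
        have "(\<lambda>Q. Q x) ` C = {0}" using that CA Q by (force simp: A_def)
        then show ?thesis by (simp add: R_def)
      qed
      ultimately have "R \<in> A" by (simp add: A_def)
      then show ?thesis using lower by (auto simp: le_def)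
    qed
  qed
  then obtain Q where Q: "Q \<in> A" "\<And>R. R \<in> A \<Longrightarrow> le Q R \<Longrightarrow> R = Q" by blast
  show ?thesis
  proof
    show "sublinear_on scl Y Q" "\<And>x. x \<in> Y \<Longrightarrow> Q x \<le> P x" using Q(1) by (auto simp: A_def)
    fix R x assume R: "sublinear_on scl Y R" "\<And>y. y \<in> Y \<Longrightarrow> R y \<le> Q y" and x: "x \<in> Y"
    have "R y \<le> P y" if "y \<in> Y" for y using R(2)[OF that] Q(1) that by (force simp: A_def)
    then have "?z R \<in> A" using sub_z[OF R(1)] by (simp add: A_def)
    moreover have "le Q (?z R)" using R(2) Q(1) by (auto simp: le_def A_def)
    ultimately have "?z R = Q" by (rule Q(2))
    then show "R x = Q x" using x fun_cong[of "?z R" Q x] by simp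
  qed
qed

text \<open>The cone lemma is used twice. With the cone \<open>Z\<close> and \<open>v = u\<close> it
  gives \<open>R \<le> P\<close> with \<open>R \<le> u\<close> on \<open>Z\<close>, because
  \<open>t = - x\<close> is allowed. A minimal \<open>Q \<le> R\<close> is linear, by the cone lemma
  for rays, and a linear functional below \<open>u\<close> on a subspace equals \<open>u\<close>
  there.\<close>

theorem hahn_banach_sublinear:
  assumes vs: "vector_space scl" and Y: "module.subspace scl Y" and P: "sublinear_on scl Y P"
    and Z: "module.subspace scl Z" "Z \<subseteq> Y"
    and u: "\<And>x y. x \<in> Z \<Longrightarrow> y \<in> Z \<Longrightarrow> u (x + y) = u x + u y"
      "\<And>r x. x \<in> Z \<Longrightarrow> u (scl r x) = r * u x" "\<And>x. x \<in> Z \<Longrightarrow> u x \<le> P x"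
  obtains U where "\<And>x y. x \<in> Y \<Longrightarrow> y \<in> Y \<Longrightarrow> U (x + y) = U x + U y"
    "\<And>r x. x \<in> Y \<Longrightarrow> U (scl r x) = r * U x"
    "\<And>x. x \<in> Z \<Longrightarrow> U x = u x" "\<And>x. x \<in> Y \<Longrightarrow> U x \<le> P x"
proof -
  interpret vector_space scl by fact
  note cl = subspace_closed[OF Y] and Zcl = subspace_closed[OF Z(1)]
  obtain R where R: "sublinear_on scl Y R" "\<And>x. x \<in> Y \<Longrightarrow> R x \<le> P x"
    "\<And>x t. x \<in> Y \<Longrightarrow> t \<in> Z \<Longrightarrow> R x \<le> P (x + t) - u t"
    by (rule sublinear_on_cone[OF vs Y P Z(2) Zcl(1), of u])
      (simp_all add: Zcl u)
  obtain Q where Q: "sublinear_on scl Y Q" "\<And>x. x \<in> Y \<Longrightarrow> Q x \<le> R x"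
    "\<And>S x. sublinear_on scl Y S \<Longrightarrow> (\<And>y. y \<in> Y \<Longrightarrow> S y \<le> Q y) \<Longrightarrow> x \<in> Y \<Longrightarrow> S x = Q x"
    by (rule minimal_sublinear_on[OF vs Y R(1)]) blast
  have Q0: "Q 0 = 0" using sublinear_on_zero[OF vs Y Q(1)] .
  have hom: "Q (scl r x) = r * Q x" if "r > 0" "x \<in> Y" for r x
  proof (rule antisym)
    show "Q (scl r x) \<le> r * Q x" using Q(1) that unfolding sublinear_on_def by blast
    \<comment> \<open>The missing direction is the inequality for the factor \<open>1/r\<close> at
      the point \<open>scl r x\<close>.\<close>
    have "Q (scl (1/r) (scl r x)) \<le> (1/r) * Q (scl r x)"
      using Q(1) that cl unfolding sublinear_on_def by (meson zero_less_divide_1_iff)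
    then show "r * Q x \<le> Q (scl r x)" using that by (simp add: field_simps)
  qed
  have add: "Q (x + y) = Q x + Q y" if x: "x \<in> Y" and y: "y \<in> Y" for x y
  proof (rule antisym)
    show "Q (x + y) \<le> Q x + Q y" using Q(1) that unfolding sublinear_on_def by blast
    \<comment> \<open>On the ray of \<open>y\<close> the functional \<open>Q\<close> is additive, so
      it can be subtracted from itself. By minimality the result \<open>S\<close> equals
      \<open>Q\<close>, which gives \<open>Q x \<le> Q (x + y) - Q y\<close>.\<close>
    define T where "T = {scl r y |r. r \<ge> 0}"
    have TY: "T \<subseteq> Y" using y cl by (auto simp: T_def)
    have QT: "Q (scl r y) = r * Q y" if "r \<ge> 0" for r
      using hom[OF _ y, of r] Q0 that by (cases "r = 0") auto
    obtain S where S: "sublinear_on scl Y S" "\<And>x. x \<in> Y \<Longrightarrow> S x \<le> Q x"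
      "\<And>x t. x \<in> Y \<Longrightarrow> t \<in> T \<Longrightarrow> S x \<le> Q (x + t) - Q t"
    proof (rule sublinear_on_cone[OF vs Y Q(1) TY, of Q])
      show "0 \<in> T" unfolding T_def by (rule CollectI, rule exI[of _ 0]) simp
      fix a b assume "a \<in> T" "b \<in> T"
      then obtain r r' where r: "a = scl r y" "b = scl r' y" "r \<ge> 0" "r' \<ge> 0"
        by (auto simp: T_def)
      have "a + b = scl (r + r') y" using r by (simp add: scale_left_distrib)
      moreover have "r + r' \<ge> 0" using r by simp
      moreover have "Q (scl (r + r') y) = (r + r') * Q y" using QT r by simp
      ultimately show "a + b \<in> T" "Q a + Q b \<le> Q (a + b)"
        using QT[of r] QT[of r'] r unfolding T_def by (blast, simp add: distrib_right)
    next
      fix c :: real and a assume "a \<in> T" "c > 0"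
      then obtain r where r: "a = scl r y" "r \<ge> 0" by (auto simp: T_def)
      have "scl c a = scl (c * r) y" "c * r \<ge> 0" using r \<open>c > 0\<close> by auto
      then show "scl c a \<in> T" unfolding T_def by blast
      show "Q (scl c a) = c * Q a" using hom \<open>c > 0\<close> \<open>a \<in> T\<close> TY by blast
    qed (auto simp: that)
    have "y \<in> T" unfolding T_def by (rule CollectI, rule exI[of _ 1]) simp
    then show "Q x + Q y \<le> Q (x + y)" using S(3)[OF x, of y] Q(3)[OF S(1,2) x] by simp
  qed
  have neg: "Q (- x) = - Q x" if "x \<in> Y" for x
    using add[of x "- x"] that cl Q0 by simp
  show ?thesis
  proof
    show "Q (x + y) = Q x + Q y" if "x \<in> Y" "y \<in> Y" for x y using add that .
    show "Q (scl r x) = r * Q x" if x: "x \<in> Y" for r x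
    proof (cases r "0::real" rule: linorder_cases)
      case less
      have "Q (scl (- r) x) = - r * Q x" by (intro hom) (use less x in auto)
      then show ?thesis using neg[of "scl r x"] cl(5)[OF x, of r] by simp
    next
      case equal
      then show ?thesis using Q0 by simp
    next
      case greater
      then show ?thesis using hom x by simp
    qed
    show "Q x \<le> P x" if "x \<in> Y" for x using Q(2)[OF that] R(2)[OF that] by simp
    have *: "Q x \<le> u x" if x: "x \<in> Z" for x
    proof -
      have xx: "x \<in> Y" "- x \<in> Z" using x Z(2) Zcl(4) by auto
      have "Q x \<le> R x" "R x \<le> P (x + - x) - u (- x)" using Q(2)[OF xx(1)] R(3)[OF xx] by blast+
      moreover have "u (- x) = - u x" using u(2)[OF x, of "-1"] by simp
      ultimately show ?thesis using sublinear_on_zero[OF vs Y P] by simp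
    qed
    show "Q x = u x" if x: "x \<in> Z" for x
    proof -
      have "- x \<in> Z" "x \<in> Y" using x Z(2) Zcl(4) by auto
      then show ?thesis using *[OF x] *[of "- x"] neg[of x] u(2)[OF x, of "-1"] by simp
    qed
  qed
qed

section \<open>Minkowski's inequality and dual norms\<close>

text \<open>The mean value theorem compares the increments over the two halves of the interval. It
  needs the derivative only at interior points, so \<open>a = 0\<close> is covered.\<close>

lemma powr_midpoint_strict:
  fixes a b q :: real
  assumes "0 \<le> a" "a < b" "1 < q"
  shows "((a + b) / 2) powr q < (a powr q + b powr q) / 2"
proof -
  define m where "m = (a + b) / 2"
  have m: "a < m" "m < b" "0 < m" using assms by (auto simp: m_def)
  have cont: "continuous_on {x..y} (\<lambda>t. t powr q)" if "0 \<le> x" for x y :: real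
    using that assms by (intro continuous_on_powr') (auto intro!: continuous_intros)
  have der: "((\<lambda>t. t powr q) has_real_derivative q * t powr (q - 1)) (at t)" if "0 < t" for t
    using that by (auto intro!: derivative_eq_intros)
  have mvt: "\<exists>x. u < x \<and> x < v \<and> v powr q - u powr q = (v - u) * (q * x powr (q - 1))"
    if uv: "0 \<le> u" "u < v" for u v
  proof -
    have "\<And>x. u < x \<Longrightarrow> x < v \<Longrightarrow> (\<lambda>t. t powr q) differentiable (at x)"
      using der uv by (meson le_less_trans real_differentiable_def)
    from MVT[OF uv(2) cont[OF uv(1)] this] obtain l x where
      "u < x" "x < v" "((\<lambda>t. t powr q) has_real_derivative l) (at x)"
      "v powr q - u powr q = (v - u) * l" by blast
    moreover have "l = q * x powr (q - 1)"
      using DERIV_unique[OF calculation(3) der] calculation(1) uv by simp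
    ultimately show ?thesis by blast
  qed
  obtain x where x: "a < x" "x < m" "m powr q - a powr q = (m - a) * (q * x powr (q - 1))"
    using mvt[OF assms(1) m(1)] by blast
  obtain y where y: "m < y" "y < b" "b powr q - m powr q = (b - m) * (q * y powr (q - 1))"
    using mvt[of m b] m by auto
  have "x powr (q - 1) < y powr (q - 1)"
    using x y assms by (intro powr_less_mono2) auto
  then have "(b - m) * (q * x powr (q - 1)) < (b - m) * (q * y powr (q - 1))"
    using m assms by simp
  moreover have *: "m - a = b - m" by (simp add: m_def field_simps)
  ultimately have "m powr q - a powr q < b powr q - m powr q"
    unfolding x(3) y(3) by (simp only: *)
  then show ?thesis by (simp add: m_def)
qed

lemma powr_midpoint:
  fixes a b q :: real
  assumes "0 \<le> a" "0 \<le> b" "1 < q"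
  shows "((a + b) / 2) powr q \<le> (a powr q + b powr q) / 2"
proof (cases a b rule: linorder_cases)
  case less then show ?thesis using powr_midpoint_strict[of a b q] assms by simp
next
  case greater then show ?thesis using powr_midpoint_strict[of b a q] assms by (simp add: add.commute)
qed simp

text \<open>When one of the points is 0, the claim reduces to \<open>w powr p \<le> w\<close> for
  \<open>w\<close> in the unit interval.\<close>

lemma powr_convex_nonneg:
  fixes x y u v p :: real
  assumes "1 \<le> p" "0 \<le> x" "0 \<le> y" "0 \<le> u" "0 \<le> v" "u + v = 1"
  shows "(u * x + v * y) powr p \<le> u * x powr p + v * y powr p"
proof -
  have le: "w powr p \<le> w" if "0 \<le> w" "w \<le> 1" for w :: real
    using powr_mono'[of 1 p w] that assms by (cases "w = 0") auto
  have z: "(w * x) powr p \<le> w * x powr p" if "0 \<le> w" "w \<le> 1" "0 \<le> x" for w x :: real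
    using le[OF that(1,2)] that by (simp add: powr_mult mult_right_mono)
  consider "x = 0" | "y = 0" | "x > 0" "y > 0" using assms by linarith
  then show ?thesis
  proof cases
    case 3
    then show ?thesis
      using convex_onD[OF powr_convex[OF assms(1)], of v x y] assms
      by (simp add: eq_diff_eq[symmetric])
  qed (use z assms in auto)
qed

lemma powr_inverse_cancel:
  fixes x p :: real
  assumes "0 \<le> x" "p \<noteq> 0"
  shows "(x powr p) powr (1 / p) = x" "(x powr (1 / p)) powr p = x"
  using assms by (auto simp: powr_powr)

text \<open>Convexity is applied to \<open>x k / c\<close> and \<open>y k / d\<close> with the
  weights \<open>c / (c + d)\<close> and \<open>d / (c + d)\<close>, where \<open>c\<close> and
  \<open>d\<close> exceed the two norms by \<open>e\<close>; the excess allows for a norm that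
  vanishes. The bounds on finite sums give summability as well.\<close>

lemma minkowski_infsum:
  fixes x y :: "'k \<Rightarrow> real"
  assumes p: "1 < p" and x: "\<And>k. 0 \<le> x k" "(\<lambda>k. x k powr p) summable_on UNIV"
    and y: "\<And>k. 0 \<le> y k" "(\<lambda>k. y k powr p) summable_on UNIV"
  shows "(\<lambda>k. (x k + y k) powr p) summable_on UNIV"
    and "(\<Sum>\<^sub>\<infinity>k. (x k + y k) powr p) powr (1/p)
      \<le> (\<Sum>\<^sub>\<infinity>k. x k powr p) powr (1/p) + (\<Sum>\<^sub>\<infinity>k. y k powr p) powr (1/p)"
proof -
  define a where "a = (\<Sum>\<^sub>\<infinity>k. x k powr p) powr (1/p)"
  define b where "b = (\<Sum>\<^sub>\<infinity>k. y k powr p) powr (1/p)"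
  have a0: "0 \<le> a" "0 \<le> b" by (auto simp: a_def b_def)
  have xa: "(\<Sum>k\<in>A. x k powr p) \<le> a powr p" if "finite A" for A
    using finite_sum_le_infsum[OF x(2) that] p by (simp add: a_def powr_inverse_cancel infsum_nonneg)
  have yb: "(\<Sum>k\<in>A. y k powr p) \<le> b powr p" if "finite A" for A
    using finite_sum_le_infsum[OF y(2) that] p by (simp add: b_def powr_inverse_cancel infsum_nonneg)
  have fin: "(\<Sum>k\<in>A. (x k + y k) powr p) \<le> (a + b + 2 * e) powr p" if A: "finite A" and e: "e > 0" for A e
  proof -
    define c d where "c = a + e" and "d = b + e"
    have cd: "c > 0" "d > 0" using a0 e by (auto simp: c_def d_def)
    have summand: "(x k + y k) powr p \<le> (c + d) powr p *
        (c / (c + d) * (x k powr p / c powr p) + d / (c + d) * (y k powr p / d powr p))" for k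
    proof -
      have "x k + y k = (c + d) * (c / (c + d) * (x k / c) + d / (c + d) * (y k / d))"
      proof -
        have "(c + d) * (c / (c + d) * (x k / c) + d / (c + d) * (y k / d))
          = (c + d) * ((x k + y k) / (c + d))"
          using cd by (simp add: add_divide_distrib)
        then show ?thesis using cd by simp
      qed
      then have "(x k + y k) powr p = (c + d) powr p * (c / (c + d) * (x k / c) + d / (c + d) * (y k / d)) powr p"
        using cd x(1)[of k] y(1)[of k] by (metis powr_mult)
      moreover have "(c / (c + d) * (x k / c) + d / (c + d) * (y k / d)) powr p
        \<le> c / (c + d) * (x k / c) powr p + d / (c + d) * (y k / d) powr p"
        using cd x(1)[of k] y(1)[of k] p
        by (intro powr_convex_nonneg) (auto simp flip: add_divide_distrib)
      ultimately show ?thesis using x(1)[of k] y(1)[of k] cd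
        by (simp add: powr_divide mult_left_mono)
    qed
    have "(\<Sum>k\<in>A. (x k + y k) powr p) \<le> (c + d) powr p *
        (c / (c + d) * ((\<Sum>k\<in>A. x k powr p) / c powr p) + d / (c + d) * ((\<Sum>k\<in>A. y k powr p) / d powr p))"
      unfolding sum_divide_distrib sum_distrib_left sum.distrib[symmetric]
      by (intro sum_mono summand)
    also have "\<dots> \<le> (c + d) powr p * (c / (c + d) * 1 + d / (c + d) * 1)"
    proof (intro mult_left_mono add_mono)
      show "(\<Sum>k\<in>A. x k powr p) / c powr p \<le> 1"
        using order_trans[OF xa[OF A] powr_mono2[of p a c]] p a0 e cd by (simp add: c_def)
      show "(\<Sum>k\<in>A. y k powr p) / d powr p \<le> 1"
        using order_trans[OF yb[OF A] powr_mono2[of p b d]] p a0 e cd by (simp add: d_def)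
    qed (use cd in auto)
    also have "\<dots> = (c + d) powr p" using cd by (simp flip: add_divide_distrib)
    finally show ?thesis by (simp add: c_def d_def algebra_simps)
  qed
  show sm: "(\<lambda>k. (x k + y k) powr p) summable_on UNIV"
    using fin[of _ 1] by (intro nonneg_bdd_above_summable_on bdd_aboveI2) auto
  have "(\<Sum>\<^sub>\<infinity>k. (x k + y k) powr p) powr (1/p) \<le> a + b + e" if "e > 0" for e
  proof -
    have "(\<Sum>\<^sub>\<infinity>k. (x k + y k) powr p) \<le> (a + b + 2 * (e / 2)) powr p"
      using fin[of _ "e/2"] that by (intro infsum_le_finite_sums[OF sm]) auto
    then have "(\<Sum>\<^sub>\<infinity>k. (x k + y k) powr p) powr (1/p) \<le> ((a + b + e) powr p) powr (1/p)"
      using p by (intro powr_mono2) (auto intro: infsum_nonneg)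
    then show ?thesis using a0 that p by (simp add: powr_inverse_cancel)
  qed
  then show "(\<Sum>\<^sub>\<infinity>k. (x k + y k) powr p) powr (1/p)
      \<le> (\<Sum>\<^sub>\<infinity>k. x k powr p) powr (1/p) + (\<Sum>\<^sub>\<infinity>k. y k powr p) powr (1/p)"
    unfolding a_def b_def by (rule field_le_epsilon)
qed

section \<open>Dual norms of a complex normed space\<close>

lemma norm_onD:
  assumes "norm_on s X N"
  shows "module.subspace s X" "\<And>x. x \<in> X \<Longrightarrow> 0 \<le> N x" "\<And>x. x \<in> X \<Longrightarrow> N x = 0 \<longleftrightarrow> x = 0"
    "\<And>x y. x \<in> X \<Longrightarrow> y \<in> X \<Longrightarrow> N (x + y) \<le> N x + N y"
    "\<And>c x. x \<in> X \<Longrightarrow> N (s c x) = cmod c * N x"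
  using assms unfolding norm_on_def by auto

lemma dualD:
  assumes "f \<in> dual s X N"
  shows "\<And>x y. x \<in> X \<Longrightarrow> y \<in> X \<Longrightarrow> f (x + y) = f x + f y"
    "\<And>c x. x \<in> X \<Longrightarrow> f (s c x) = c * f x" "\<And>x. x \<notin> X \<Longrightarrow> f x = 0"
    "\<exists>C. \<forall>x\<in>X. cmod (f x) \<le> C * N x"
  using assms unfolding dual_def by auto

locale complex_normed = vector_space s
  for s :: "complex \<Rightarrow> 'v \<Rightarrow> 'v::ab_group_add" and X :: "'v set" and N :: "'v \<Rightarrow> real" +
  assumes nrm: "norm_on s X N"
begin

lemmas nD = norm_onD[OF nrm]
lemmas cl = subspace_closed[OF nD(1)]

lemma N0: "N 0 = 0" using nD(3)[of 0] cl(1) by blast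

lemma dual_bdd:
  assumes "f \<in> dual s X N"
  shows "bdd_above ((\<lambda>x. cmod (f x)) ` {x\<in>X. N x \<le> 1})"
proof -
  obtain C where C: "\<And>x. x \<in> X \<Longrightarrow> cmod (f x) \<le> C * N x" using dualD(4)[OF assms] by blast
  have "cmod (f x) \<le> \<bar>C\<bar>" if "x \<in> X" "N x \<le> 1" for x
  proof -
    have "C * N x \<le> \<bar>C\<bar> * 1" using nD(2)[OF that(1)] that by (intro mult_mono) auto
    with C[OF that(1)] show ?thesis by simp
  qed
  then show ?thesis by (intro bdd_aboveI2) auto
qed

lemma dual_norm_nonneg:
  assumes "f \<in> dual s X N"
  shows "0 \<le> dual_norm X N f"
  unfolding dual_norm_def
  by (rule cSUP_upper2[OF dual_bdd[OF assms], of 0]) (use cl N0 in auto)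

lemma dual_norm_bound:
  assumes f: "f \<in> dual s X N" and x: "x \<in> X"
  shows "cmod (f x) \<le> dual_norm X N f * N x"
proof (cases "x = 0")
  case True
  have "f (s 0 0) = 0 * f 0" using dualD(2)[OF f cl(1)] by blast
  then show ?thesis using True N0 by simp
next
  case False
  then have pos: "N x > 0" using nD(2,3)[OF x] by linarith
  let ?y = "s (1 / of_real (N x)) x"
  have y: "?y \<in> X" "N ?y = 1" using pos x cl(5) nD(5)[OF x] by (auto simp: norm_divide)
  have "cmod (f ?y) \<le> dual_norm X N f"
    unfolding dual_norm_def using y by (intro cSUP_upper[OF _ dual_bdd[OF f]]) auto
  then show ?thesis using pos dualD(2)[OF f x] by (simp add: norm_divide norm_mult field_simps)
qed

lemma dual_norm_least:
  assumes "\<And>x. x \<in> X \<Longrightarrow> cmod (f x) \<le> C * N x" "0 \<le> C"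
  shows "dual_norm X N f \<le> C"
  unfolding dual_norm_def
proof (rule cSUP_least)
  show "{x \<in> X. N x \<le> 1} \<noteq> {}" using cl(1) N0 by auto
  fix x assume x: "x \<in> {x \<in> X. N x \<le> 1}"
  then have "C * N x \<le> C * 1" using assms(2) by (intro mult_left_mono) auto
  with assms(1)[of x] x show "cmod (f x) \<le> C" by simp
qed

lemma dual_norm_approx:
  assumes "f \<in> dual s X N" "c < dual_norm X N f"
  obtains x where "x \<in> X" "N x \<le> 1" "c < cmod (f x)"
proof -
  have "{x \<in> X. N x \<le> 1} \<noteq> {}" using cl(1) N0 by auto
  from less_cSUP_iff[OF this dual_bdd[OF assms(1)], of c] assms(2) that show ?thesis
    unfolding dual_norm_def by auto
qed

lemma dual_midpoint:
  assumes f: "f \<in> dual s X N" and g: "g \<in> dual s X N"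
  shows "scale_fun (1/2) (f + g) \<in> dual s X N"
    and "dual_norm X N (scale_fun (1/2) (f + g)) \<le> (dual_norm X N f + dual_norm X N g) / 2"
proof -
  have b: "cmod (scale_fun (1/2) (f + g) x) \<le> (dual_norm X N f + dual_norm X N g) / 2 * N x"
    if x: "x \<in> X" for x
    using norm_triangle_ineq[of "f x" "g x"] dual_norm_bound[OF f x] dual_norm_bound[OF g x]
    by (simp add: scale_fun_def norm_divide algebra_simps)
  then have "\<exists>C. \<forall>x\<in>X. cmod (scale_fun (1/2) (f + g) x) \<le> C * N x" by blast
  then show "scale_fun (1/2) (f + g) \<in> dual s X N"
    using dualD(1-3)[OF f] dualD(1-3)[OF g]
    unfolding dual_def by (simp add: scale_fun_def algebra_simps add_divide_distrib)
  show "dual_norm X N (scale_fun (1/2) (f + g)) \<le> (dual_norm X N f + dual_norm X N g) / 2"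
    using b dual_norm_nonneg[OF f] dual_norm_nonneg[OF g] by (intro dual_norm_least) auto
qed

end

section \<open>Functionals on sums of normed spaces\<close>

lemma unit_rotation:
  obtains c where "cmod c = 1" "c * w = of_real (cmod w)"
proof (cases "w = 0")
  case True then show ?thesis using that[of 1] by simp
next
  case False
  have "cnj w * w = of_real (cmod w) * of_real (cmod w)"
    using complex_norm_square[of w] by (simp add: power2_eq_square mult.commute)
  then show ?thesis
    using that[of "cnj w / of_real (cmod w)"] False by (simp add: norm_divide)
qed

lemma dual_scaled:
  assumes "0 < w"
  shows "dual s X (\<lambda>x. w * N x) = dual s X N"
proof (intro set_eqI iffI)
  fix f
  { assume "f \<in> dual s X (\<lambda>x. w * N x)"
    then show "f \<in> dual s X N" unfolding dual_def
      by (force simp: mult.assoc[symmetric]) }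
  { assume "f \<in> dual s X N"
    then obtain C where "\<forall>x\<in>X. cmod (f x) \<le> C * N x" using dualD(4) by blast
    then have "\<forall>x\<in>X. cmod (f x) \<le> (C / w) * (w * N x)" using assms by simp
    then show "f \<in> dual s X (\<lambda>x. w * N x)" using \<open>f \<in> dual s X N\<close> unfolding dual_def by blast }
qed

section \<open>The l^p-sum of a family of normed spaces\<close>

locale lp_sum = vector_space s
  for s :: "complex \<Rightarrow> 'v \<Rightarrow> 'v::ab_group_add" +
  fixes X :: "'k \<Rightarrow> 'v set" and N :: "'k \<Rightarrow> 'v \<Rightarrow> real" and p :: real
  assumes nrm: "norm_on s (X k) (N k)" and p1: "1 < p"
begin

sublocale comp: complex_normed s "X k" "N k" for k
  by unfold_locales (rule nrm)

definition seq_scale :: "complex \<Rightarrow> ('k \<Rightarrow> 'v) \<Rightarrow> 'k \<Rightarrow> 'v" where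
  "seq_scale c z = (\<lambda>k. s c (z k))"

sublocale seq: vector_space seq_scale
  by unfold_locales (auto simp: seq_scale_def fun_eq_iff scale_right_distrib scale_left_distrib)

text \<open>Restriction of scalars to the reals, the setting of
  \<open>hahn_banach_sublinear\<close>.\<close>

sublocale real_seq: vector_space "\<lambda>r. seq_scale (of_real r)"
  by unfold_locales
    (auto simp: seq_scale_def fun_eq_iff scale_right_distrib scale_left_distrib)

definition lp_space :: "('k \<Rightarrow> 'v) set" where
  "lp_space = {z. (\<forall>k. z k \<in> X k) \<and> (\<lambda>k. N k (z k) powr p) summable_on UNIV}"

definition lp_norm :: "('k \<Rightarrow> 'v) \<Rightarrow> real" where
  "lp_norm z = (\<Sum>\<^sub>\<infinity>k. N k (z k) powr p) powr (1 / p)"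

lemma lp_spaceD: "z \<in> lp_space \<Longrightarrow> z k \<in> X k" "z \<in> lp_space \<Longrightarrow> (\<lambda>k. N k (z k) powr p) summable_on UNIV"
  "z \<in> lp_space \<Longrightarrow> 0 \<le> N k (z k)"
  by (auto simp: lp_space_def comp.nD(2))

lemma lp_norm_nonneg: "0 \<le> lp_norm z"
  by (simp add: lp_norm_def)

lemma lp_norm_powr: "lp_norm z powr p = (\<Sum>\<^sub>\<infinity>k. N k (z k) powr p)"
  using p1 by (simp add: lp_norm_def powr_inverse_cancel infsum_nonneg)

lemma lp_norm_component:
  assumes "z \<in> lp_space"
  shows "N k (z k) \<le> lp_norm z"
proof -
  have "N k (z k) powr p \<le> lp_norm z powr p"
    using finite_sum_le_infsum[OF lp_spaceD(2)[OF assms], of "{k}"] by (simp add: lp_norm_powr)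
  then show ?thesis
    using p1 lp_spaceD(3)[OF assms] lp_norm_nonneg by (metis linorder_not_le powr_less_mono2 less_trans zero_less_one)
qed

lemma lp_norm_le:
  assumes "(\<Sum>\<^sub>\<infinity>k. N k (z k) powr p) \<le> c powr p" "0 \<le> c"
  shows "lp_norm z \<le> c"
proof -
  have "lp_norm z \<le> (c powr p) powr (1 / p)"
    unfolding lp_norm_def using assms p1 by (intro powr_mono2) (auto intro: infsum_nonneg)
  then show ?thesis using assms p1 by (simp add: powr_inverse_cancel)
qed

lemma lp_add:
  assumes z: "z \<in> lp_space" and w: "w \<in> lp_space"
  shows "z + w \<in> lp_space" "lp_norm (z + w) \<le> lp_norm z + lp_norm w"
proof -
  note m = minkowski_infsum[OF p1 lp_spaceD(3)[OF z] lp_spaceD(2)[OF z] lp_spaceD(3)[OF w] lp_spaceD(2)[OF w]]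
  have zw: "(z + w) k \<in> X k" for k using comp.cl z w by (simp add: lp_spaceD)
  have le: "N k ((z + w) k) powr p \<le> (N k (z k) + N k (w k)) powr p" for k
    using comp.nD(4) comp.nD(2)[OF zw] z w p1 by (intro powr_mono2) (auto simp: lp_spaceD)
  have sm: "(\<lambda>k. N k ((z + w) k) powr p) summable_on UNIV"
    by (rule summable_on_comparison_test[OF m(1) le]) auto
  then show "z + w \<in> lp_space" using zw by (simp add: lp_space_def)
  have "lp_norm (z + w) \<le> (\<Sum>\<^sub>\<infinity>k. (N k (z k) + N k (w k)) powr p) powr (1 / p)"
    unfolding lp_norm_def using p1 by (intro powr_mono2 infsum_mono sm m(1) le) (auto intro: infsum_nonneg)
  with m(2) show "lp_norm (z + w) \<le> lp_norm z + lp_norm w" by (simp add: lp_norm_def)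
qed

lemma lp_scale:
  assumes z: "z \<in> lp_space"
  shows "seq_scale c z \<in> lp_space" "lp_norm (seq_scale c z) = cmod c * lp_norm z"
proof -
  have eq: "N k (seq_scale c z k) powr p = cmod c powr p * N k (z k) powr p" for k
    using comp.nD(5)[of "z k" k c] lp_spaceD[OF z] by (simp add: seq_scale_def powr_mult)
  show "seq_scale c z \<in> lp_space"
    using lp_spaceD(1)[OF z] comp.cl(5) summable_on_cmult_right[OF lp_spaceD(2)[OF z]]
    unfolding lp_space_def mem_Collect_eq eq by (simp add: seq_scale_def)
  show "lp_norm (seq_scale c z) = cmod c * lp_norm z"
    unfolding lp_norm_def eq using p1
    by (simp add: infsum_cmult_right' powr_mult infsum_nonneg powr_inverse_cancel)
qed

lemma lp_subspace: "seq.subspace lp_space" "real_seq.subspace lp_space"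
proof -
  have "0 \<in> lp_space" using comp.cl comp.N0 p1 by (simp add: lp_space_def)
  then show "seq.subspace lp_space" "real_seq.subspace lp_space"
    unfolding seq.subspace_def real_seq.subspace_def using lp_add lp_scale by auto
qed

lemmas lp_cl = seq.subspace_closed[OF lp_subspace(1)]

text \<open>The constant 1 in the bound is a normalisation: these functionals form the unit ball of
  the dual of the sum, and only functionals of dual norm at most 1 are lifted.\<close>

definition lp_functional :: "(('k \<Rightarrow> 'v) \<Rightarrow> complex) \<Rightarrow> bool" where
  "lp_functional F \<longleftrightarrow> (\<forall>z\<in>lp_space. \<forall>w\<in>lp_space. F (z + w) = F z + F w) \<and>
     (\<forall>c. \<forall>z\<in>lp_space. F (seq_scale c z) = c * F z) \<and> (\<forall>z\<in>lp_space. cmod (F z) \<le> lp_norm z)"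

lemma lp_functionalD:
  assumes "lp_functional F"
  shows "\<And>z w. z \<in> lp_space \<Longrightarrow> w \<in> lp_space \<Longrightarrow> F (z + w) = F z + F w"
    "\<And>c z. z \<in> lp_space \<Longrightarrow> F (seq_scale c z) = c * F z"
    "\<And>z. z \<in> lp_space \<Longrightarrow> cmod (F z) \<le> lp_norm z"
  using assms unfolding lp_functional_def by auto

text \<open>The real part of \<open>f\<close> is extended below \<open>lp_norm\<close> over the
  reals; a complex linear functional is recovered from its real part, and rotating the argument
  turns the one-sided bound into a bound on the modulus.\<close>

lemma hahn_banach_complex:
  assumes Z: "seq.subspace Z" "Z \<subseteq> lp_space"
    and f: "\<And>z w. z \<in> Z \<Longrightarrow> w \<in> Z \<Longrightarrow> f (z + w) = f z + f w"
      "\<And>c z. z \<in> Z \<Longrightarrow> f (seq_scale c z) = c * f z"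
      "\<And>z. z \<in> Z \<Longrightarrow> cmod (f z) \<le> lp_norm z"
  obtains F where "lp_functional F"
    "\<And>z. z \<in> Z \<Longrightarrow> F z = f z"
proof -
  have "sublinear_on (\<lambda>r. seq_scale (of_real r)) lp_space lp_norm"
    unfolding sublinear_on_def using lp_add lp_scale by simp
  moreover have "real_seq.subspace Z"
    using Z(1) unfolding seq.subspace_def real_seq.subspace_def by simp
  ultimately obtain U where U: "\<And>x y. x \<in> lp_space \<Longrightarrow> y \<in> lp_space \<Longrightarrow> U (x + y) = U x + U y"
    "\<And>r x. x \<in> lp_space \<Longrightarrow> U (seq_scale (of_real r) x) = r * U x"
    "\<And>x. x \<in> Z \<Longrightarrow> U x = Re (f x)" "\<And>x. x \<in> lp_space \<Longrightarrow> U x \<le> lp_norm x"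
    by (rule hahn_banach_sublinear[OF real_seq.vector_space_axioms lp_subspace(2) _ _ Z(2), of _ "\<lambda>z. Re (f z)"])
      (auto simp: f intro: order_trans[OF complex_Re_le_cmod])
  \<comment> \<open>Complex linearity forces
    \<open>Im (F z) = - Re (F (seq_scale \<i> z))\<close>.\<close>
  define F where "F z = Complex (U z) (- U (seq_scale \<i> z))" for z
  have add: "F (z + w) = F z + F w" if "z \<in> lp_space" "w \<in> lp_space" for z w
    using U(1) that lp_scale(1) by (simp add: F_def complex_eq_iff seq.scale_right_distrib)
  have scale: "F (seq_scale c z) = c * F z" if z: "z \<in> lp_space" for c z
  proof -
    have c: "seq_scale c z = seq_scale (of_real (Re c)) z + seq_scale (of_real (Im c)) (seq_scale \<i> z)"
      by (simp add: seq.scale_left_distrib[symmetric] complex_eq mult.commute)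
    have "seq_scale \<i> (seq_scale c z) = seq_scale (of_real (Re c)) (seq_scale \<i> z) + seq_scale (of_real (- Im c)) z"
    proof -
      have "\<i> * c = of_real (Re c) * \<i> + of_real (- Im c)" by (simp add: complex_eq_iff)
      then show ?thesis by (simp only: seq.scale_scale seq.scale_left_distrib[symmetric])
    qed
    then have "U (seq_scale \<i> (seq_scale c z)) = Re c * U (seq_scale \<i> z) - Im c * U z"
      using U(1)[OF lp_scale(1)[OF lp_scale(1)[OF z]] lp_scale(1)[OF z], of "of_real (Re c)" \<i> "of_real (- Im c)"]
        U(2)[OF lp_scale(1)[OF z], of "Re c" \<i>] U(2)[OF z, of "- Im c"] by simp
    moreover have "U (seq_scale c z) = Re c * U z + Im c * U (seq_scale \<i> z)"
      unfolding c
      using U(1)[OF lp_scale(1)[OF z] lp_scale(1)[OF lp_scale(1)[OF z]], of "of_real (Re c)" "of_real (Im c)" \<i>]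
        U(2)[OF lp_scale(1)[OF z], of "Im c" \<i>] U(2)[OF z, of "Re c"] by simp
    ultimately show ?thesis by (simp add: F_def complex_eq_iff)
  qed
  have bound: "cmod (F z) \<le> lp_norm z" if z: "z \<in> lp_space" for z
  proof -
    obtain c where c: "cmod c = 1" "c * F z = of_real (cmod (F z))" by (rule unit_rotation)
    have "cmod (F z) = U (seq_scale c z)"
      using scale[OF z, of c] c(2) by (simp add: F_def complex_eq_iff)
    also have "\<dots> \<le> lp_norm z" using U(4)[of "seq_scale c z"] lp_scale[OF z] c(1) by simp
    finally show ?thesis .
  qed
  show ?thesis
  proof
    show "lp_functional F" unfolding lp_functional_def using add scale bound by blast
    show "F z = f z" if z: "z \<in> Z" for z
      using U(3)[OF z] U(3)[of "seq_scale \<i> z"] f(2)[OF z] seq.subspace_scale[OF Z(1) z]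
      by (simp add: F_def complex_eq_iff)
  qed
qed

section \<open>Components of a functional and their l^q bound\<close>

definition component :: "(('k \<Rightarrow> 'v) \<Rightarrow> complex) \<Rightarrow> 'k \<Rightarrow> 'v \<Rightarrow> complex" where
  "component F k x = (if x \<in> X k then F (0(k := x)) else 0)"

lemma finite_support:
  assumes A: "finite A" and z: "\<And>k. k \<in> A \<Longrightarrow> z k \<in> X k" "\<And>k. k \<notin> A \<Longrightarrow> z k = 0"
  shows "z \<in> lp_space" "(\<Sum>\<^sub>\<infinity>k. N k (z k) powr p) = (\<Sum>k\<in>A. N k (z k) powr p)"
proof -
  have 0: "N k (z k) powr p = 0" if "k \<notin> A" for k using z(2)[OF that] comp.N0 p1 by simp
  have "((\<lambda>k. N k (z k) powr p) has_sum (\<Sum>k\<in>A. N k (z k) powr p)) UNIV"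
    using has_sum_cong_neutral[of A UNIV "\<lambda>k. N k (z k) powr p" "\<lambda>k. N k (z k) powr p"] 0 has_sum_finite[OF A]
    by auto
  moreover have "z k \<in> X k" for k using z comp.cl(1) by (cases "k \<in> A") auto
  ultimately show "z \<in> lp_space" "(\<Sum>\<^sub>\<infinity>k. N k (z k) powr p) = (\<Sum>k\<in>A. N k (z k) powr p)"
    by (auto simp: lp_space_def infsumI dest: has_sum_imp_summable)
qed

lemma single:
  assumes "x \<in> X k"
  shows "0(k := x) \<in> lp_space" "lp_norm (0(k := x)) = N k x"
  using finite_support[of "{k}" "0(k := x)"] assms p1
  by (auto simp: lp_norm_def powr_inverse_cancel comp.nD(2))

context
  fixes F :: "('k \<Rightarrow> 'v) \<Rightarrow> complex"
  assumes F: "lp_functional F"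
begin

lemmas F_add = lp_functionalD(1)[OF F] and F_scale = lp_functionalD(2)[OF F]
  and F_bound = lp_functionalD(3)[OF F]

lemma component_dual: "component F k \<in> dual s (X k) (N k)"
proof -
  have "component F k (x + y) = component F k x + component F k y" if "x \<in> X k" "y \<in> X k" for x y
  proof -
    have "0(k := x + y) = 0(k := x) + 0(k := y)" by (auto simp: fun_eq_iff)
    then show ?thesis using F_add[OF single(1) single(1)] that comp.cl(2) by (simp add: component_def)
  qed
  moreover have "component F k (s c x) = c * component F k x" if "x \<in> X k" for c x
  proof -
    have "0(k := s c x) = seq_scale c (0(k := x))" by (auto simp: fun_eq_iff seq_scale_def)
    then show ?thesis using F_scale[OF single(1)] that comp.cl(5) by (simp add: component_def)
  qed
  moreover have "cmod (component F k x) \<le> 1 * N k x" if "x \<in> X k" for x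
    using F_bound[OF single(1)[OF that]] single(2)[OF that] that by (simp add: component_def)
  ultimately have "(\<forall>x\<in>X k. \<forall>y\<in>X k. component F k (x + y) = component F k x + component F k y)"
    "(\<forall>c. \<forall>x\<in>X k. component F k (s c x) = c * component F k x)"
    "\<exists>C. \<forall>x\<in>X k. cmod (component F k x) \<le> C * N k x" by blast+
  \<comment> \<open>Membership in \<open>dual\<close> demands the value 0 outside
    \<open>X k\<close>, which the \<open>else\<close> branch of \<open>component\<close>
    supplies.\<close>
  then show ?thesis unfolding dual_def by (simp add: component_def)
qed

lemma component_finite_sum:
  assumes "finite A" "\<And>k. k \<in> A \<Longrightarrow> z k \<in> X k" "\<And>k. k \<notin> A \<Longrightarrow> z k = 0"
  shows "F z = (\<Sum>k\<in>A. component F k (z k))"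
  using assms
proof (induction A arbitrary: z rule: finite_induct)
  case empty
  then have z0: "z = 0" by (simp add: fun_eq_iff)
  have "F 0 = 0" using F_scale[OF lp_cl(1), of 0] by simp
  then have "F z = 0" by (simp only: z0)
  then show ?case by simp
next
  case (insert k A)
  define w where "w = z(k := 0)"
  have w: "\<And>j. j \<in> A \<Longrightarrow> w j \<in> X j" "\<And>j. j \<notin> A \<Longrightarrow> w j = 0"
    using insert by (auto simp: w_def)
  have "z = 0(k := z k) + w" by (auto simp: w_def fun_eq_iff)
  then have "F z = F (0(k := z k)) + F w"
    using F_add[OF single(1)[of "z k" k] finite_support(1)[OF insert.hyps(1) w]] insert.prems(1) by auto
  moreover have "(\<Sum>j\<in>A. component F j (w j)) = (\<Sum>j\<in>A. component F j (z j))"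
    using insert.hyps by (intro sum.cong) (auto simp: w_def)
  ultimately show ?case using insert.IH[OF w] insert by (simp add: component_def)
qed

lemma component_has_sum:
  assumes z: "z \<in> lp_space"
  shows "((\<lambda>k. component F k (z k)) has_sum F z) UNIV"
proof -
  define g where "g k = N k (z k) powr p" for k
  define S where "S = (\<Sum>\<^sub>\<infinity>k. g k)"
  have gS: "(g has_sum S) UNIV" using lp_spaceD(2)[OF z] by (simp add: g_def[abs_def] S_def)
  \<comment> \<open>The error is \<open>F\<close> of the remaining coordinates, and their norm is
    the p-th root of a tail of a convergent sum.\<close>
  have bound: "cmod ((\<Sum>k\<in>A. component F k (z k)) - F z) \<le> (S - sum g A) powr (1/p)" if A: "finite A" for A
  proof -
    define a where "a k = (if k \<in> A then z k else 0)" for k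
    define b where "b k = (if k \<in> A then 0 else z k)" for k
    have a: "a \<in> lp_space" "F a = (\<Sum>k\<in>A. component F k (z k))"
      using finite_support(1)[OF A, of a] component_finite_sum[OF A, of a] lp_spaceD(1)[OF z]
      by (simp_all add: a_def)
    have "(g has_sum (S - sum g A)) (UNIV - A)"
      by (intro has_sum_Diff gS has_sum_finite A) auto
    then have bs: "((\<lambda>k. N k (b k) powr p) has_sum (S - sum g A)) UNIV"
      by (rule has_sum_cong_neutral[THEN iffD1, rotated -1]) (use comp.N0 p1 in \<open>auto simp: b_def g_def\<close>)
    have "b = z - a" by (auto simp: fun_eq_iff a_def b_def)
    then have b: "b \<in> lp_space" using lp_cl(3)[OF z a(1)] by simp
    have "z = a + b" by (auto simp: fun_eq_iff a_def b_def)
    then have "F z = F a + F b" using F_add[OF a(1) b] by simp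
    then show ?thesis using F_bound[OF b] a(2) infsumI[OF bs] by (simp add: lp_norm_def)
  qed
  have "((\<lambda>A. (S - sum g A) powr (1/p)) \<longlongrightarrow> (S - S) powr (1/p)) (finite_subsets_at_top UNIV)"
  proof (intro tendsto_intros)
    show "(sum g \<longlongrightarrow> S) (finite_subsets_at_top UNIV)" using gS unfolding has_sum_def .
    have "sum g A \<le> S" if "finite A" for A
      using finite_sum_le_infsum[OF lp_spaceD(2)[OF z] that] by (simp add: S_def g_def)
    then show "S - S \<noteq> 0 \<or> 0 < 1 / p \<and> (\<forall>\<^sub>F A in finite_subsets_at_top UNIV. 0 \<le> S - sum g A)"
      using p1 by (auto intro: eventually_finite_subsets_at_top_weakI)
  qed
  then have "((\<lambda>A. (S - sum g A) powr (1/p)) \<longlongrightarrow> 0) (finite_subsets_at_top UNIV)" using p1 by simp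
  then have "((\<lambda>A. (\<Sum>k\<in>A. component F k (z k)) - F z) \<longlongrightarrow> 0) (finite_subsets_at_top UNIV)"
    by (rule Lim_null_comparison[rotated])
      (intro eventually_finite_subsets_at_top_weakI, use bound in auto)
  then show ?thesis unfolding has_sum_def by (simp add: LIM_zero_iff)
qed

text \<open>The converse of Hoelder's inequality. \<open>F\<close> is tested on a finitely supported
  \<open>z\<close> whose coordinates have norm at most \<open>\<phi> k powr (q - 1)\<close> and
  values close to \<open>\<phi> k powr q\<close>. Young's inequality with second factor 1 then gives
  \<open>T \<le> T / p + 1 / q\<close> up to a small error, hence \<open>T \<le> 1\<close>, without
  division by a power of \<open>T\<close>.\<close>

lemma component_dual_norm_sum:
  assumes q: "1 < q" "1 / p + 1 / q = 1" and A: "finite A"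
  shows "(\<Sum>k\<in>A. dual_norm (X k) (N k) (component F k) powr q) \<le> 1"
proof -
  define \<phi> where "\<phi> k = dual_norm (X k) (N k) (component F k)" for k
  have \<phi>0: "0 \<le> \<phi> k" for k unfolding \<phi>_def by (intro comp.dual_norm_nonneg component_dual)
  define T V where "T = (\<Sum>k\<in>A. \<phi> k powr q)" and "V = (\<Sum>k\<in>A. \<phi> k powr (q - 1))"
  have V0: "0 \<le> V" by (auto simp: V_def intro: sum_nonneg)
  have pq: "(q - 1) * p = q" using q p1 by (simp add: field_simps)
  have "T \<le> T / p + 1 / q + e * V" if e: "e > 0" for e
  proof -
    have "\<exists>y. y \<in> X k \<and> N k y \<le> \<phi> k powr (q - 1) \<and>
        (\<exists>r. component F k y = of_real r \<and> \<phi> k powr q - e * \<phi> k powr (q - 1) \<le> r)" for k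
    proof -
      obtain x where x: "x \<in> X k" "N k x \<le> 1" "\<phi> k - e < cmod (component F k x)"
        using comp.dual_norm_approx[OF component_dual, of "\<phi> k - e" k] e unfolding \<phi>_def by auto
      obtain c where c: "cmod c = 1" "c * component F k x = of_real (cmod (component F k x))"
        by (rule unit_rotation)
      define t where "t = \<phi> k powr (q - 1)"
      \<comment> \<open>The rotation \<open>c\<close> makes the value real and nonnegative, and
        \<open>t\<close> adjusts the length.\<close>
      define y where "y = s (of_real t * c) x"
      have t0: "0 \<le> t" by (simp add: t_def)
      have y: "y \<in> X k" "N k y = t * N k x"
        using x comp.cl(5) comp.nD(5)[OF x(1)] c(1) t0 by (auto simp: y_def norm_mult)
      have Fy: "component F k y = of_real (t * cmod (component F k x))"
        using dualD(2)[OF component_dual x(1)] c(2) by (simp add: y_def mult.assoc)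
      have "\<phi> k powr q = t * \<phi> k"
        using \<phi>0[of k] q by (cases "\<phi> k = 0") (auto simp: t_def powr_diff)
      then have "\<phi> k powr q - e * t = t * (\<phi> k - e)" by (simp add: algebra_simps)
      also have "\<dots> \<le> t * cmod (component F k x)" using x(3) t0 by (intro mult_left_mono) auto
      finally have "\<phi> k powr q - e * t \<le> t * cmod (component F k x)" .
      moreover have "N k y \<le> t" using y(2) mult_left_le[OF x(2) t0] by simp
      ultimately show ?thesis unfolding t_def[symmetric] using y(1) Fy by (intro exI conjI)
    qed
    then obtain y r where y: "\<And>k. y k \<in> X k" "\<And>k. N k (y k) \<le> \<phi> k powr (q - 1)"
      "\<And>k. component F k (y k) = of_real (r k)" "\<And>k. \<phi> k powr q - e * \<phi> k powr (q - 1) \<le> r k"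
      by metis
    define z where "z k = (if k \<in> A then y k else 0)" for k
    have z: "\<And>k. k \<in> A \<Longrightarrow> z k \<in> X k" "\<And>k. k \<notin> A \<Longrightarrow> z k = 0" using y(1) by (auto simp: z_def)
    have fs: "z \<in> lp_space" "(\<Sum>\<^sub>\<infinity>k. N k (z k) powr p) = (\<Sum>k\<in>A. N k (z k) powr p)"
      using finite_support[OF A, of z] z by simp_all
    have "F z = (\<Sum>k\<in>A. component F k (z k))" by (rule component_finite_sum[OF A z])
    also have "\<dots> = (\<Sum>k\<in>A. of_real (r k))" using y(3) by (intro sum.cong) (auto simp: z_def)
    finally have "F z = of_real (\<Sum>k\<in>A. r k)" by simp
    then have "(\<Sum>k\<in>A. r k) \<le> lp_norm z"
      using F_bound[OF fs(1)] by (metis complex_Re_le_cmod Re_complex_of_real order_trans)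
    also have "\<dots> \<le> lp_norm z powr p / p + 1 / q"
      using Youngs_inequality[OF p1 q lp_norm_nonneg[of z], of 1] by simp
    also have "lp_norm z powr p \<le> T"
      unfolding lp_norm_powr fs(2) T_def
    proof (intro sum_mono)
      fix k assume "k \<in> A"
      then have "N k (z k) powr p \<le> (\<phi> k powr (q - 1)) powr p"
        using y p1 comp.nD(2) by (intro powr_mono2) (auto simp: z_def)
      then show "N k (z k) powr p \<le> \<phi> k powr q" using pq by (simp add: powr_powr)
    qed
    finally have "(\<Sum>k\<in>A. r k) \<le> T / p + 1 / q" using p1 by (simp add: divide_right_mono)
    moreover have "T - e * V \<le> (\<Sum>k\<in>A. r k)"
      unfolding T_def V_def sum_distrib_left sum_subtractf[symmetric] by (intro sum_mono y(4))
    ultimately show ?thesis by simp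
  qed
  moreover have "T * (1 / q) = T - T / p"
  proof -
    have "1 / q = 1 - 1 / p" using q(2) by linarith
    then show ?thesis by (simp only:) (simp add: right_diff_distrib)
  qed
  ultimately have *: "T * (1 / q) \<le> 1 / q + e * V" if "e > 0" for e
    using that by (smt (verit))
  have "T * (1 / q) \<le> 1 / q + d" if "d > 0" for d
  proof -
    \<comment> \<open>The divisor is \<open>V + 1\<close> because \<open>V\<close> may be 0.\<close>
    have "d / (V + 1) * V \<le> d" using that V0 by (simp add: field_simps)
    moreover have "d / (V + 1) > 0" using that V0 by simp
    ultimately show ?thesis using *[of "d / (V + 1)"] by simp
  qed
  then have "T * (1 / q) \<le> 1 / q" by (rule field_le_epsilon)
  then have "T \<le> 1" using q(1) by (simp add: divide_le_cancel)
  then show ?thesis by (simp add: T_def \<phi>_def)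
qed

lemma component_summable:
  assumes q: "1 < q" "1 / p + 1 / q = 1"
  shows "(\<lambda>k. dual_norm (X k) (N k) (component F k) powr q) summable_on UNIV"
    and "(\<Sum>\<^sub>\<infinity>k. dual_norm (X k) (N k) (component F k) powr q) \<le> 1"
proof -
  let ?\<phi> = "\<lambda>k. dual_norm (X k) (N k) (component F k)"
  show sm: "(\<lambda>k. ?\<phi> k powr q) summable_on UNIV"
    using component_dual_norm_sum[OF q] by (intro nonneg_bdd_above_summable_on bdd_aboveI2) auto
  show "(\<Sum>\<^sub>\<infinity>k. ?\<phi> k powr q) \<le> 1"
    using component_dual_norm_sum[OF q] by (intro infsum_le_finite_sums[OF sm]) auto
qed

text \<open>Young's inequality term by term gives an additive form of Hoelder's inequality. It
  suffices where it is applied, since there the first sum is close to 1 and the left side is close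
  to 1.\<close>

lemma component_holder:
  assumes q: "1 < q" "1 / p + 1 / q = 1" and z: "z \<in> lp_space"
  shows "cmod (F z) \<le> (\<Sum>\<^sub>\<infinity>k. N k (z k) powr p) / p
      + (\<Sum>\<^sub>\<infinity>k. dual_norm (X k) (N k) (component F k) powr q) / q"
proof -
  let ?\<phi> = "\<lambda>k. dual_norm (X k) (N k) (component F k)"
  note sm = component_summable(1)[OF q]
  have "cmod (\<Sum>k\<in>A. component F k (z k)) \<le> (\<Sum>\<^sub>\<infinity>k. N k (z k) powr p) / p + (\<Sum>\<^sub>\<infinity>k. ?\<phi> k powr q) / q"
    if A: "finite A" for A
  proof -
    have "cmod (\<Sum>k\<in>A. component F k (z k)) \<le> (\<Sum>k\<in>A. N k (z k) powr p / p + ?\<phi> k powr q / q)"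
    proof (rule sum_norm_le)
      fix k
      have "cmod (component F k (z k)) \<le> N k (z k) * ?\<phi> k"
        using comp.dual_norm_bound[OF component_dual lp_spaceD(1)[OF z]] by (simp add: mult.commute)
      also have "\<dots> \<le> N k (z k) powr p / p + ?\<phi> k powr q / q"
        by (intro Youngs_inequality p1 q lp_spaceD(3)[OF z] comp.dual_norm_nonneg component_dual)
      finally show "cmod (component F k (z k)) \<le> N k (z k) powr p / p + ?\<phi> k powr q / q" .
    qed
    also have "\<dots> = (\<Sum>k\<in>A. N k (z k) powr p) / p + (\<Sum>k\<in>A. ?\<phi> k powr q) / q"
      by (simp add: sum.distrib sum_divide_distrib)
    also have "\<dots> \<le> (\<Sum>\<^sub>\<infinity>k. N k (z k) powr p) / p + (\<Sum>\<^sub>\<infinity>k. ?\<phi> k powr q) / q"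
      using p1 q(1) by (intro add_mono divide_right_mono finite_sum_le_infsum sm lp_spaceD(2)[OF z] A) auto
    finally show ?thesis .
  qed
  then have "\<forall>\<^sub>F A in finite_subsets_at_top UNIV. cmod (\<Sum>k\<in>A. component F k (z k))
      \<le> (\<Sum>\<^sub>\<infinity>k. N k (z k) powr p) / p + (\<Sum>\<^sub>\<infinity>k. ?\<phi> k powr q) / q"
    by (intro eventually_finite_subsets_at_top_weakI)
  then show "cmod (F z) \<le> (\<Sum>\<^sub>\<infinity>k. N k (z k) powr p) / p + (\<Sum>\<^sub>\<infinity>k. ?\<phi> k powr q) / q"
    by (rule tendsto_upperbound[OF tendsto_norm[OF component_has_sum[OF z, unfolded has_sum_def]] _
          finite_subsets_at_top_neq_bot])
qed

end

end

section \<open>Scaling of dual norms, and rotundity on spheres of any radius\<close>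

context complex_normed begin

lemma complex_normed_scaled:
  assumes "0 < w"
  shows "complex_normed s X (\<lambda>x. w * N x)"
proof (unfold_locales)
  have "w * N (x + y) \<le> w * N x + w * N y" if "x \<in> X" "y \<in> X" for x y
    using mult_left_mono[OF nD(4)[OF that], of w] assms by (simp add: distrib_left)
  then show "norm_on s X (\<lambda>x. w * N x)"
    using assms nD(1,2,3,5) unfolding norm_on_def by (simp add: mult.left_commute)
qed

lemma dual_norm_weighted:
  assumes w: "0 < w" and f: "f \<in> dual s X N"
  shows "dual_norm X (\<lambda>x. w * N x) f = dual_norm X N f / w"
proof (rule antisym)
  interpret w: complex_normed s X "\<lambda>x. w * N x" using complex_normed_scaled[OF w] .
  have f': "f \<in> dual s X (\<lambda>x. w * N x)" using f dual_scaled[OF w] by blast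
  show "dual_norm X (\<lambda>x. w * N x) f \<le> dual_norm X N f / w"
    using w dual_norm_nonneg[OF f] dual_norm_bound[OF f] by (intro w.dual_norm_least) auto
  have "dual_norm X N f \<le> dual_norm X (\<lambda>x. w * N x) f * w"
    using w w.dual_norm_nonneg[OF f'] w.dual_norm_bound[OF f']
    by (intro dual_norm_least) (auto simp: mult.assoc)
  then show "dual_norm X N f / w \<le> dual_norm X (\<lambda>x. w * N x) f" using w by (simp add: field_simps)
qed

lemma dual_scale_fun:
  assumes f: "f \<in> dual s X N"
  shows "scale_fun c f \<in> dual s X N" "dual_norm X N (scale_fun c f) \<le> cmod c * dual_norm X N f"
proof -
  have b: "cmod (scale_fun c f x) \<le> (cmod c * dual_norm X N f) * N x" if "x \<in> X" for x
    using mult_left_mono[OF dual_norm_bound[OF f that], of "cmod c"]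
    by (simp add: scale_fun_def norm_mult mult.assoc)
  then have "\<exists>C. \<forall>x\<in>X. cmod (scale_fun c f x) \<le> C * N x" by blast
  then show "scale_fun c f \<in> dual s X N"
    using dualD(1-3)[OF f] unfolding dual_def by (simp add: scale_fun_def algebra_simps)
  show "dual_norm X N (scale_fun c f) \<le> cmod c * dual_norm X N f"
    using b dual_norm_nonneg[OF f] by (intro dual_norm_least) auto
qed

lemma dual_norm_scale_fun:
  assumes f: "f \<in> dual s X N"
  shows "dual_norm X N (scale_fun c f) = cmod c * dual_norm X N f"
proof (cases "c = 0")
  case True
  then show ?thesis using dual_scale_fun[OF f, of 0] dual_norm_nonneg[OF dual_scale_fun(1)[OF f, of 0]] by simp
next
  case False
  have "scale_fun (1 / c) (scale_fun c f) = f" using False by (auto simp: scale_fun_def)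
  then have "dual_norm X N f \<le> cmod (1 / c) * dual_norm X N (scale_fun c f)"
    using dual_scale_fun(2)[OF dual_scale_fun(1)[OF f], of "1 / c" c] by simp
  then have "cmod c * dual_norm X N f \<le> dual_norm X N (scale_fun c f)"
    using False by (simp add: norm_divide field_simps)
  with dual_scale_fun(2)[OF f, of c] show ?thesis by simp
qed

text \<open>\<open>rotund\<close> speaks of the unit sphere; division by the common norm transfers
  it to every sphere. If the common norm is 0, both functionals vanish.\<close>

lemma rotund_dual_eq:
  assumes rot: "rotund scale_fun (dual s X N) (dual_norm X N)"
    and f: "f \<in> dual s X N" and g: "g \<in> dual s X N"
    and eq: "dual_norm X N g = dual_norm X N f"
      "dual_norm X N (scale_fun (1/2) (f + g)) = dual_norm X N f"
  shows "f = g"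
proof (cases "dual_norm X N f = 0")
  case True
  have "f x = 0 \<and> g x = 0" for x
    using dual_norm_bound[OF f, of x] dual_norm_bound[OF g, of x] True eq(1) dualD(3)[OF f] dualD(3)[OF g]
    by (cases "x \<in> X") auto
  then show ?thesis by auto
next
  case False
  define r where "r = dual_norm X N f"
  have r: "r > 0" using False dual_norm_nonneg[OF f] by (simp add: r_def)
  define c where "c = complex_of_real (1 / r)"
  have c: "cmod c * r = 1" "c \<noteq> 0" using r by (auto simp: c_def norm_divide)
  have "scale_fun (1/2) (scale_fun c f + scale_fun c g) = scale_fun c (scale_fun (1/2) (f + g))"
    by (auto simp: scale_fun_def fun_eq_iff algebra_simps)
  then have "dual_norm X N (scale_fun (1/2) (scale_fun c f + scale_fun c g)) = 1"
    using dual_norm_scale_fun[OF dual_midpoint(1)[OF f g], of c] eq c by (simp add: r_def)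
  moreover have "dual_norm X N (scale_fun c f) = 1" "dual_norm X N (scale_fun c g) = 1"
    using dual_norm_scale_fun f g eq c by (auto simp: r_def)
  ultimately have "scale_fun c f = scale_fun c g"
    using rot dual_scale_fun(1)[OF f] dual_scale_fun(1)[OF g] unfolding rotund_def by fastforce
  then show ?thesis using c(2) by (auto simp: scale_fun_def fun_eq_iff)
qed

end

lemma has_sum_uminusI:
  fixes f :: "'a \<Rightarrow> 'b::topological_ab_group_add"
  shows "(f has_sum a) A \<Longrightarrow> ((\<lambda>x. - f x) has_sum - a) A"
  by (simp add: has_sum_uminus)

text \<open>By \<open>approx\<close> and Hoelder, the q-th powers of the component norms of the
  midpoint \<open>H\<close> sum to at least 1, while those of \<open>F\<close> and of
  \<open>G\<close> sum to at most 1. The convexity defects \<open>d k\<close> are nonnegative with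
  nonpositive sum, so each is 0, and strict convexity of the power yields both equalities.\<close>

lemma (in lp_sum) component_midpoint:
  assumes F: "lp_functional F" and G: "lp_functional G"
    and approx: "\<And>e. e > 0 \<Longrightarrow> \<exists>z\<in>lp_space. lp_norm z powr p \<le> 1 + e \<and> 1 - e \<le> cmod ((F z + G z) / 2)"
  shows "dual_norm (X k) (N k) (component G k) = dual_norm (X k) (N k) (component F k)"
    and "dual_norm (X k) (N k) (scale_fun (1/2) (component F k + component G k))
      = dual_norm (X k) (N k) (component F k)"
proof -
  define q where "q = p / (p - 1)"
  have q: "1 < q" "1 / p + 1 / q = 1" using p1 by (auto simp: q_def field_simps)
  define H where "H z = (F z + G z) / 2" for z
  have H: "lp_functional H"
    unfolding lp_functional_def
  proof (intro conjI ballI allI)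
    fix z w assume zw: "z \<in> lp_space" "w \<in> lp_space"
    show "H (z + w) = H z + H w"
      using lp_functionalD(1)[OF F zw] lp_functionalD(1)[OF G zw] by (simp add: H_def add_divide_distrib)
  next
    fix c z assume z: "z \<in> lp_space"
    show "H (seq_scale c z) = c * H z"
      using lp_functionalD(2)[OF F z] lp_functionalD(2)[OF G z] by (simp add: H_def distrib_left)
  next
    fix z assume z: "z \<in> lp_space"
    show "cmod (H z) \<le> lp_norm z"
      using norm_triangle_ineq[of "F z" "G z"] lp_functionalD(3)[OF F z] lp_functionalD(3)[OF G z]
      by (simp add: H_def norm_divide)
  qed
  have comp_H: "component H k = scale_fun (1/2) (component F k + component G k)" for k
    by (auto simp: component_def H_def scale_fun_def fun_eq_iff)
  define \<phi> \<gamma> \<eta> where "\<phi> k = dual_norm (X k) (N k) (component F k)"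
    and "\<gamma> k = dual_norm (X k) (N k) (component G k)"
    and "\<eta> k = dual_norm (X k) (N k) (component H k)" for k
  note Fk = component_dual[OF F] and Gk = component_dual[OF G] and Hk = component_dual[OF H]
  have nn: "0 \<le> \<phi> k" "0 \<le> \<gamma> k" "0 \<le> \<eta> k" for k
    using comp.dual_norm_nonneg Fk Gk Hk by (auto simp: \<phi>_def \<gamma>_def \<eta>_def)
  note sF = component_summable[OF F q, folded \<phi>_def] and sG = component_summable[OF G q, folded \<gamma>_def]
    and sH = component_summable[OF H q, folded \<eta>_def]
  define S where "S = (\<Sum>\<^sub>\<infinity>k. \<eta> k powr q)"
  have "1 \<le> 1 / p + S / q + e" if e: "e > 0" for e
  proof -
    obtain z where z: "z \<in> lp_space" "lp_norm z powr p \<le> 1 + e / 2" "1 - e / 2 \<le> cmod (H z)"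
      using approx[of "e / 2"] e unfolding H_def by auto
    have "cmod (H z) \<le> lp_norm z powr p / p + S / q"
      using component_holder[OF H q z(1)] by (simp add: lp_norm_powr \<eta>_def S_def)
    also have "lp_norm z powr p / p \<le> (1 + e / 2) / p"
      using z(2) p1 by (intro divide_right_mono) auto
    also have "(1 + e / 2) / p \<le> 1 / p + e / 2"
      using p1 e by (simp add: add_divide_distrib divide_le_eq mult_le_cancel_left1)
    finally show ?thesis using z(3) by simp
  qed
  then have "1 \<le> 1 / p + S / q" by (rule field_le_epsilon)
  then have "1 / q \<le> S / q" using q(2) by linarith
  then have S: "1 \<le> S" using q(1) by (simp add: divide_le_cancel)
  define d where "d k = (\<phi> k powr q + \<gamma> k powr q) / 2 - \<eta> k powr q" for k
  have mid: "\<eta> k powr q \<le> ((\<phi> k + \<gamma> k) / 2) powr q" for k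
    using comp.dual_midpoint(2)[OF Fk Gk] nn q(1) unfolding comp_H[symmetric] \<phi>_def[symmetric] \<gamma>_def[symmetric] \<eta>_def[symmetric]
    by (intro powr_mono2) auto
  have d0: "0 \<le> d k" for k
    using mid[of k] powr_midpoint[OF nn(1,2) q(1), of k k] by (simp add: d_def)
  have "(d has_sum (((\<Sum>\<^sub>\<infinity>k. \<phi> k powr q) + (\<Sum>\<^sub>\<infinity>k. \<gamma> k powr q)) * (1/2) + - S)) UNIV"
    unfolding d_def[abs_def] S_def
    using has_sum_add[OF has_sum_cmult_left[where c = "1/2", OF has_sum_add[OF has_sum_infsum[OF sF(1)] has_sum_infsum[OF sG(1)]]]
      has_sum_uminusI[OF has_sum_infsum[OF sH(1)]]] by simp
  then have ds: "d summable_on UNIV" "(\<Sum>\<^sub>\<infinity>k. d k) \<le> 0"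
    using S sF(2) sG(2) by (auto simp: has_sum_imp_summable dest: infsumI)
  have d: "d k = 0" for k
    using finite_sum_le_infsum[OF ds(1), of "{k}"] ds(2) d0 by (simp add: antisym)
  have eq: "\<phi> k = \<gamma> k" for k
    using powr_midpoint_strict[OF nn(1), of k "\<gamma> k" q] powr_midpoint_strict[OF nn(2), of k "\<phi> k" q] d[of k] mid[of k] q(1)
    by (cases "\<phi> k" "\<gamma> k" rule: linorder_cases) (auto simp: d_def add.commute)
  moreover have "\<eta> k = \<phi> k" for k
  proof -
    have "\<eta> k powr q = \<phi> k powr q" using d[of k] unfolding d_def eq[symmetric] by simp
    then have "(\<eta> k powr q) powr (1 / q) = (\<phi> k powr q) powr (1 / q)" by simp
    then show ?thesis using powr_inverse_cancel(1)[OF nn(1)] powr_inverse_cancel(1)[OF nn(3)] q(1) by simp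
  qed
  ultimately show "dual_norm (X k) (N k) (component G k) = dual_norm (X k) (N k) (component F k)"
    "dual_norm (X k) (N k) (scale_fun (1/2) (component F k + component G k))
      = dual_norm (X k) (N k) (component F k)"
    by (simp_all add: \<phi>_def \<gamma>_def \<eta>_def comp_H)
qed

section \<open>The quotient norm of a couple\<close>

locale normed_couple = vector_space s
  for s :: "complex \<Rightarrow> 'v \<Rightarrow> 'v::ab_group_add" +
  fixes B0 B1 :: "'v set" and N0 N1 :: "'v \<Rightarrow> real" and \<theta> p :: real
  assumes nrm0: "norm_on s B0 N0" and nrm1: "norm_on s B1 N1"
    and \<theta>: "0 < \<theta>" "\<theta> < 1" and p: "1 < p"
begin

sublocale n0: complex_normed s B0 N0 by unfold_locales (rule nrm0)
sublocale n1: complex_normed s B1 N1 by unfold_locales (rule nrm1)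

text \<open>For \<open>t = 2 powr m\<close> the quantity
  \<open>t powr (-\<theta>) * (N0 x + t * N1 y)\<close> splits into the two weighted norms;
  \<open>False\<close> marks copies of \<open>B0\<close> and \<open>True\<close> copies of
  \<open>B1\<close>.\<close>

definition weight :: "int \<times> bool \<Rightarrow> real" where
  "weight k = 2 powr (of_int (fst k) * ((if snd k then 1 else 0) - \<theta>))"

definition dyadic_space :: "int \<times> bool \<Rightarrow> 'v set" where
  "dyadic_space k = (if snd k then B1 else B0)"

definition dyadic_norm :: "int \<times> bool \<Rightarrow> 'v \<Rightarrow> real" where
  "dyadic_norm k x = weight k * (if snd k then N1 x else N0 x)"

lemma weight_pos: "0 < weight k"
  by (simp add: weight_def)

sublocale lp_sum s dyadic_space dyadic_norm p
proof
  show "norm_on s (dyadic_space k) (dyadic_norm k)" for k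
    using complex_normed.nrm[OF n0.complex_normed_scaled[OF weight_pos]]
      complex_normed.nrm[OF n1.complex_normed_scaled[OF weight_pos]]
    unfolding dyadic_space_def dyadic_norm_def[abs_def] by (cases "snd k") auto
qed (rule p)

definition reps :: "'v \<Rightarrow> (int \<times> bool \<Rightarrow> 'v) set" where
  "reps a = {z \<in> lp_space. \<forall>m. z (m, False) + z (m, True) = a}"

text \<open>A quotient norm: the nonempty sets \<open>reps a\<close> are the cosets of
  \<open>reps 0\<close> in their union.\<close>

definition quot_norm :: "'v \<Rightarrow> real" where
  "quot_norm a = (INF z\<in>reps a. lp_norm z)"

definition quot_space :: "'v set" where
  "quot_space = {a. reps a \<noteq> {}}"

lemma repsD:
  assumes "z \<in> reps a"
  shows "z \<in> lp_space" "z (m, False) + z (m, True) = a" "z (m, False) \<in> B0" "z (m, True) \<in> B1"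
    "weight (m, False) * N0 (z (m, False)) \<le> lp_norm z" "weight (m, True) * N1 (z (m, True)) \<le> lp_norm z"
  using assms lp_spaceD(1)[of z "(m, False)"] lp_spaceD(1)[of z "(m, True)"]
    lp_norm_component[of z "(m, False)"] lp_norm_component[of z "(m, True)"]
  by (auto simp: reps_def dyadic_space_def dyadic_norm_def)

lemma reps_add: "z \<in> reps a \<Longrightarrow> w \<in> reps b \<Longrightarrow> z + w \<in> reps (a + b)"
  using lp_add(1) by (auto simp: reps_def algebra_simps)

lemma reps_scale: "z \<in> reps a \<Longrightarrow> seq_scale c z \<in> reps (s c a)"
  using lp_scale(1) by (auto simp: reps_def seq_scale_def scale_right_distrib[symmetric])

lemma reps_zero: "0 \<in> reps 0"
  using lp_cl(1) by (simp add: reps_def)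

lemma lp_norm_zero: "lp_norm 0 = 0"
  using lp_scale(2)[OF lp_cl(1), of 0] by simp

lemma quot_norm_le:
  assumes "z \<in> reps a"
  shows "quot_norm a \<le> lp_norm z"
  unfolding quot_norm_def using assms lp_norm_nonneg by (intro cINF_lower bdd_belowI2[where m = 0]) auto

lemma quot_norm_greatest:
  assumes "a \<in> quot_space" "\<And>z. z \<in> reps a \<Longrightarrow> c \<le> lp_norm z"
  shows "c \<le> quot_norm a"
  unfolding quot_norm_def using assms by (intro cINF_greatest) (auto simp: quot_space_def)

lemma quot_norm_approx:
  assumes "a \<in> quot_space" "quot_norm a < c"
  obtains z where "z \<in> reps a" "lp_norm z < c"
  using quot_norm_greatest[OF assms(1), of c] assms(2) by force

lemma quot_norm_nonneg: "a \<in> quot_space \<Longrightarrow> 0 \<le> quot_norm a"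
  using lp_norm_nonneg by (intro quot_norm_greatest)

lemma quot_subspace: "subspace quot_space"
  unfolding subspace_def quot_space_def using reps_zero reps_add reps_scale by (auto; blast)

lemma quot_norm_add:
  assumes a: "a \<in> quot_space" and b: "b \<in> quot_space"
  shows "quot_norm (a + b) \<le> quot_norm a + quot_norm b"
proof -
  have *: "quot_norm (a + b) \<le> lp_norm z + lp_norm w" if "z \<in> reps a" "w \<in> reps b" for z w
    using quot_norm_le[OF reps_add[OF that]] lp_add(2)[OF repsD(1)[OF that(1)] repsD(1)[OF that(2)]] by simp
  have "quot_norm (a + b) - lp_norm z \<le> quot_norm b" if "z \<in> reps a" for z
    using *[OF that] by (intro quot_norm_greatest[OF b]) (simp add: diff_le_eq add.commute)
  then have "quot_norm (a + b) - quot_norm b \<le> quot_norm a"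
    by (intro quot_norm_greatest[OF a]) (simp add: diff_le_eq add.commute)
  then show ?thesis by simp
qed

lemma quot_norm_scale_le:
  assumes a: "a \<in> quot_space"
  shows "quot_norm (s c a) \<le> cmod c * quot_norm a"
proof (cases "c = 0")
  case True
  then show ?thesis using quot_norm_le[OF reps_zero] lp_norm_zero by simp
next
  case False
  have "quot_norm (s c a) / cmod c \<le> quot_norm a"
  proof (rule quot_norm_greatest[OF a])
    fix z assume z: "z \<in> reps a"
    show "quot_norm (s c a) / cmod c \<le> lp_norm z"
      using quot_norm_le[OF reps_scale[OF z, of c]] lp_scale(2)[OF repsD(1)[OF z], of c] False
      by (simp add: divide_le_eq mult.commute)
  qed
  then show ?thesis using False by (simp add: divide_le_eq mult.commute)
qed

lemma quot_norm_scale: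
  assumes a: "a \<in> quot_space"
  shows "quot_norm (s c a) = cmod c * quot_norm a"
proof (rule antisym)
  show "cmod c * quot_norm a \<le> quot_norm (s c a)"
  proof (cases "c = 0")
    case True
    then show ?thesis using quot_norm_nonneg subspace_0[OF quot_subspace] by simp
  next
    case False
    have "quot_norm (s (1 / c) (s c a)) \<le> cmod (1 / c) * quot_norm (s c a)"
      using subspace_scale[OF quot_subspace a] by (rule quot_norm_scale_le)
    then show ?thesis using False by (simp add: norm_divide field_simps)
  qed
qed (rule quot_norm_scale_le[OF a])

text \<open>The trace of the Hausdorff ambient space inside this purely normed setting: it makes
  \<open>quot_norm\<close> definite and the K-functional positive away from 0.\<close>

definition separated :: bool where
  "separated \<longleftrightarrow> (\<forall>a. (\<forall>e>0. \<exists>x\<in>B0. \<exists>y\<in>B1. a = x + y \<and> N0 x < e \<and> N1 y < e) \<longrightarrow> a = 0)"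

lemma separatedD:
  assumes separated "\<And>e. e > 0 \<Longrightarrow> \<exists>x\<in>B0. \<exists>y\<in>B1. a = x + y \<and> N0 x < e \<and> N1 y < e"
  shows "a = 0"
  using assms unfolding separated_def by blast

lemma norm_on_quot:
  assumes sep: separated
  shows "norm_on s quot_space quot_norm"
  unfolding norm_on_def
proof (intro conjI ballI allI iffI)
  fix a assume a: "a \<in> quot_space" "quot_norm a = 0"
  show "a = 0"
  proof (rule separatedD[OF sep])
    fix e :: real assume "e > 0"
    then obtain z where z: "z \<in> reps a" "lp_norm z < e"
      using quot_norm_approx[OF a(1)] a(2) by metis
    show "\<exists>x\<in>B0. \<exists>y\<in>B1. a = x + y \<and> N0 x < e \<and> N1 y < e"
      \<comment> \<open>At index 0 both weights equal 1.\<close>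
      using repsD(2-6)[OF z(1), of 0] z(2) unfolding weight_def
      by (intro bexI[of _ "z (0, False)"] bexI[of _ "z (0, True)"]) auto
  qed
qed (use quot_subspace quot_norm_nonneg quot_norm_add quot_norm_scale quot_norm_le[OF reps_zero] lp_norm_zero
      subspace_0[OF quot_subspace] in \<open>auto intro: antisym\<close>)

section \<open>Lifting functionals from the quotient to the sum\<close>

definition represents :: "((int \<times> bool \<Rightarrow> 'v) \<Rightarrow> complex) \<Rightarrow> ('v \<Rightarrow> complex) \<Rightarrow> bool" where
  "represents F f \<longleftrightarrow> lp_functional F \<and> (\<forall>a. \<forall>z\<in>reps a. F z = f a)"

lemma representsD:
  assumes "represents F f"
  shows "lp_functional F" "\<And>z a. z \<in> reps a \<Longrightarrow> F z = f a"
  using assms unfolding represents_def by auto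

text \<open>Passing to the quotient does not increase the norm, so the pullback of \<open>f\<close>
  to the union of the \<open>reps a\<close> is bounded by \<open>lp_norm\<close> and extends to the
  whole sum.\<close>

lemma quot_functional_extension:
  assumes nrm: "norm_on s quot_space quot_norm"
    and f: "f \<in> dual s quot_space quot_norm" "dual_norm quot_space quot_norm f \<le> 1"
  obtains F where "represents F f"
proof -
  interpret q: complex_normed s quot_space quot_norm by unfold_locales (rule nrm)
  define Z where "Z = (\<Union>a. reps a)"
  \<comment> \<open>The level 0 is an arbitrary choice: families in \<open>Z\<close> have the same
    sum at every level.\<close>
  define f' where "f' z = f (z (0, False) + z (0, True))" for z :: "int \<times> bool \<Rightarrow> 'v"
  have f': "f' z = f a" "a \<in> quot_space" if "z \<in> reps a" for z a
    using repsD(2)[OF that] that by (auto simp: f'_def quot_space_def)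
  have "seq.subspace Z"
    unfolding seq.subspace_def Z_def
    by (intro conjI ballI allI; (elim UN_E)?; rule UN_I[OF UNIV_I])
      (assumption | rule reps_zero reps_add reps_scale)+
  moreover have "Z \<subseteq> lp_space" by (auto simp: Z_def reps_def)
  moreover have "f' (z + w) = f' z + f' w" if zw: "z \<in> Z" "w \<in> Z" for z w
  proof -
    obtain a b where ab: "z \<in> reps a" "w \<in> reps b" using zw by (auto simp: Z_def)
    show ?thesis using f'[OF ab(1)] f'[OF ab(2)] f'[OF reps_add[OF ab]] dualD(1)[OF f(1)] by simp
  qed
  moreover have "f' (seq_scale c z) = c * f' z" if z: "z \<in> Z" for c z
  proof -
    obtain a where a: "z \<in> reps a" using z by (auto simp: Z_def)
    show ?thesis using f'[OF a] f'[OF reps_scale[OF a]] dualD(2)[OF f(1)] by simp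
  qed
  moreover have "cmod (f' z) \<le> lp_norm z" if z: "z \<in> Z" for z
  proof -
    obtain a where a: "z \<in> reps a" using z by (auto simp: Z_def)
    have "cmod (f' z) \<le> dual_norm quot_space quot_norm f * quot_norm a"
      using q.dual_norm_bound[OF f(1)] f'[OF a] by simp
    also have "\<dots> \<le> 1 * quot_norm a" using f(2) quot_norm_nonneg f'(2)[OF a] by (intro mult_right_mono)
    finally show ?thesis using quot_norm_le[OF a] by simp
  qed
  ultimately obtain F where "lp_functional F" "\<And>z. z \<in> Z \<Longrightarrow> F z = f' z"
    by (rule hahn_banach_complex[of Z f']) blast+
  moreover from this(2) have "F z = f a" if "z \<in> reps a" for z a
  proof -
    have "z \<in> Z" using that by (auto simp: Z_def)
    then show ?thesis using \<open>\<And>z. z \<in> Z \<Longrightarrow> F z = f' z\<close> f'(1)[OF that] by simp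
  qed
  ultimately show ?thesis by (intro that[of F]) (auto simp: represents_def)
qed

text \<open>The family with \<open>b\<close> at \<open>(m, False)\<close>, \<open>- b\<close> at
  \<open>(m, True)\<close> and 0 elsewhere represents 0, so \<open>F\<close> vanishes on it.\<close>

lemma component_eq_on_Int:
  assumes rep: "represents F f" and b: "b \<in> B0" "b \<in> B1"
  shows "component F (m, False) b = component F (m, True) b"
proof -
  note F = representsD[OF rep]
  let ?x = "0((m, False) := b)" and ?y = "0((m, True) := b)"
  have X: "?x \<in> lp_space" "?y \<in> lp_space" using b by (auto intro!: single(1) simp: dyadic_space_def)
  note y = lp_functionalD(2)[OF F(1) X(2), of "-1"]
  have "seq_scale (-1) ?y \<in> lp_space" using lp_scale(1)[OF X(2)] .
  from lp_add(1)[OF X(1) this] lp_functionalD(1)[OF F(1) X(1) this] y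
  have "?x + seq_scale (-1) ?y \<in> reps 0" "F (?x + seq_scale (-1) ?y) = F ?x - F ?y"
    by (auto simp: reps_def seq_scale_def)
  moreover have "F (?x + seq_scale (-1) ?y) = F 0"
    using F(2)[OF calculation(1)] F(2)[OF reps_zero] by simp
  moreover have "F 0 = 0" using lp_functionalD(2)[OF F(1) lp_cl(1), of 0] by simp
  ultimately show ?thesis using b by (simp add: component_def dyadic_space_def)
qed

text \<open>The components with index \<open>(m, True)\<close> need not agree on \<open>B1\<close>; but their difference vanishes on
  \<open>B0 \<inter> B1\<close>, hence takes the same value at all \<open>z (M, True)\<close>, and these tend to \<open>0\<close> in \<open>B1\<close>.\<close>

lemma functional_determined:
  assumes rF: "represents F f" and rG: "represents G g"
    and eq: "\<And>m. component F (m, False) = component G (m, False)"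
    and z: "z \<in> reps a"
  shows "f a = g a"
proof -
  note F = representsD[OF rF] and G = representsD[OF rG]
  have eqT: "component F (m, True) (z (m, True)) = component G (m, True) (z (m, True))" for m
  proof -
    define D where "D x = component F (m, True) x - component G (m, True) x" for x
    note Fd = component_dual[OF F(1), of "(m, True)"] and Gd = component_dual[OF G(1), of "(m, True)"]
    have B1: "dyadic_space (m, True) = B1" by (simp add: dyadic_space_def)
    have add: "D (x + y) = D x + D y" if "x \<in> B1" "y \<in> B1" for x y
      using dualD(1)[OF Fd] dualD(1)[OF Gd] that by (simp add: D_def B1)
    have int: "D b = 0" if "b \<in> B0" "b \<in> B1" for b
      using component_eq_on_Int[OF rF that, of m] component_eq_on_Int[OF rG that, of m] eq[of m]
      by (simp add: D_def)
    obtain C where C: "\<And>x. x \<in> B1 \<Longrightarrow> cmod (D x) \<le> C * N1 x"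
    proof -
      define c where "c = (dual_norm B1 (dyadic_norm (m, True)) (component F (m, True))
        + dual_norm B1 (dyadic_norm (m, True)) (component G (m, True))) * weight (m, True)"
      have "cmod (D x) \<le> c * N1 x" if "x \<in> B1" for x
        using comp.dual_norm_bound[OF Fd, of x] comp.dual_norm_bound[OF Gd, of x] that
          norm_triangle_ineq4[of "component F (m, True) x" "component G (m, True) x"]
        by (simp add: D_def B1 c_def dyadic_norm_def algebra_simps)
      then show ?thesis by (rule that)
    qed
    have same: "D (z (m, True)) = D (z (M, True))" for M
    proof -
      \<comment> \<open>Both levels represent \<open>a\<close>, so this difference of
        \<open>B1\<close> parts is also a difference of \<open>B0\<close> parts and lies in
        \<open>B0 \<inter> B1\<close>.\<close>
      have "z (m, True) - z (M, True) = z (M, False) - z (m, False)"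
        using repsD(2)[OF z, of m] repsD(2)[OF z, of M] by (simp add: algebra_simps)
      then have "D (z (m, True) - z (M, True)) = 0"
        using n0.cl(3)[OF repsD(3)[OF z, of M] repsD(3)[OF z, of m]]
          n1.cl(3)[OF repsD(4)[OF z, of m] repsD(4)[OF z, of M]] by (intro int) auto
      then show ?thesis
        using add[OF n1.cl(3)[OF repsD(4)[OF z, of m] repsD(4)[OF z, of M]] repsD(4)[OF z, of M]] by simp
    qed
    \<comment> \<open>\<open>r ^ n\<close> is the reciprocal of the weight at
      \<open>(int n, True)\<close>, and \<open>\<theta> < 1\<close> makes it tend to 0.\<close>
    define r where "r = 2 powr (\<theta> - 1)"
    have r: "0 < r" "r < 1" using \<theta> powr_less_mono[of "\<theta> - 1" 0 2] by (auto simp: r_def)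
    have "cmod (D (z (m, True))) \<le> \<bar>C\<bar> * lp_norm z * r ^ n" for n
    proof -
      have w: "weight (int n, True) * r ^ n = 1"
        by (simp add: weight_def r_def powr_realpow[symmetric] powr_powr powr_add[symmetric] algebra_simps)
      have "N1 (z (int n, True)) = weight (int n, True) * N1 (z (int n, True)) * r ^ n"
        using w by (simp add: mult.commute mult.left_commute)
      also have "\<dots> \<le> lp_norm z * r ^ n"
        using repsD(6)[OF z, of "int n"] r by (intro mult_right_mono) auto
      finally have N1: "N1 (z (int n, True)) \<le> lp_norm z * r ^ n" .
      have "cmod (D (z (m, True))) \<le> C * N1 (z (int n, True))"
        using C[OF repsD(4)[OF z]] same[of "int n"] by simp
      also have "\<dots> \<le> \<bar>C\<bar> * (lp_norm z * r ^ n)"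
        using N1 n1.nD(2)[OF repsD(4)[OF z, of "int n"]] by (intro mult_mono) auto
      finally show ?thesis by (simp add: mult.assoc)
    qed
    moreover have "(\<lambda>n. \<bar>C\<bar> * lp_norm z * r ^ n) \<longlonglongrightarrow> \<bar>C\<bar> * lp_norm z * 0"
      using r by (intro tendsto_intros LIMSEQ_realpow_zero) auto
    ultimately have "cmod (D (z (m, True))) \<le> \<bar>C\<bar> * lp_norm z * 0"
      by (intro LIMSEQ_le_const) auto
    then show ?thesis by (simp add: D_def)
  qed
  have "component F k (z k) = component G k (z k)" for k
    using eqT[of "fst k"] eq[of "fst k"] by (cases k; cases "snd k") auto
  then have "(\<lambda>k. component F k (z k)) = (\<lambda>k. component G k (z k))" by auto
  then have "F z = G z"
    using component_has_sum[OF F(1) repsD(1)[OF z]] component_has_sum[OF G(1) repsD(1)[OF z]]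
    by (metis has_sum_unique)
  then show ?thesis using F(2)[OF z] G(2)[OF z] by simp
qed

text \<open>On representatives, the midpoint of the lifts has the values of
  \<open>(f + g) / 2\<close>; elements that nearly norm the latter therefore supply the vectors that
  \<open>component_midpoint\<close> asks for. Rotundity then acts at the copies of
  \<open>B0\<close>.\<close>

theorem rotund_quot_dual:
  assumes nrm: "norm_on s quot_space quot_norm"
    and rot: "rotund scale_fun (dual s B0 N0) (dual_norm B0 N0)"
  shows "rotund scale_fun (dual s quot_space quot_norm) (dual_norm quot_space quot_norm)"
  unfolding rotund_def
proof (intro ballI impI, elim conjE, rule ccontr)
  interpret q: complex_normed s quot_space quot_norm by unfold_locales (rule nrm)
  fix f g assume f: "f \<in> dual s quot_space quot_norm" "dual_norm quot_space quot_norm f = 1"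
    and g: "g \<in> dual s quot_space quot_norm" "dual_norm quot_space quot_norm g = 1"
    and ne: "f \<noteq> g" and nl: "\<not> dual_norm quot_space quot_norm (scale_fun (1/2) (f + g)) < 1"
  obtain F where rF: "represents F f"
    using quot_functional_extension[OF nrm f(1)] f(2) by auto
  obtain G where rG: "represents G g"
    using quot_functional_extension[OF nrm g(1)] g(2) by auto
  note F = representsD[OF rF] and G = representsD[OF rG]
  have approx: "\<exists>z\<in>lp_space. lp_norm z powr p \<le> 1 + e \<and> 1 - e \<le> cmod ((F z + G z) / 2)" if e: "e > 0" for e
  proof -
    have "1 - e < dual_norm quot_space quot_norm (scale_fun (1/2) (f + g))" using nl e by simp
    then obtain a where a: "a \<in> quot_space" "quot_norm a \<le> 1" "1 - e < cmod (scale_fun (1/2) (f + g) a)"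
      using q.dual_norm_approx[OF q.dual_midpoint(1)[OF f(1) g(1)]] by blast
    \<comment> \<open>The room above 1 admits a representative of \<open>a\<close> whose norm,
      raised to the power \<open>p\<close>, is at most \<open>1 + e\<close>.\<close>
    have "1 < (1 + e) powr (1 / p)" using e p powr_less_mono2[of "1 / p" 1 "1 + e"] by simp
    then obtain z where z: "z \<in> reps a" "lp_norm z < (1 + e) powr (1 / p)"
      using quot_norm_approx[OF a(1)] a(2) by (metis le_less_trans)
    have "lp_norm z powr p \<le> ((1 + e) powr (1 / p)) powr p"
      using z(2) p lp_norm_nonneg by (intro powr_mono2) auto
    then have "lp_norm z powr p \<le> 1 + e" using e p by (simp add: powr_inverse_cancel)
    moreover have "1 - e \<le> cmod ((F z + G z) / 2)"
      using a(3) F(2)[OF z(1)] G(2)[OF z(1)] by (simp add: scale_fun_def)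
    ultimately show ?thesis using repsD(1)[OF z(1)] by blast
  qed
  have mid: "dual_norm (dyadic_space k) (dyadic_norm k) (component G k) = dual_norm (dyadic_space k) (dyadic_norm k) (component F k)"
    "dual_norm (dyadic_space k) (dyadic_norm k) (scale_fun (1/2) (component F k + component G k))
      = dual_norm (dyadic_space k) (dyadic_norm k) (component F k)" for k
    by (rule component_midpoint(1)[OF F(1) G(1)], erule approx,
        rule component_midpoint(2)[OF F(1) G(1)], erule approx)
  have "component F (m, False) = component G (m, False)" for m
  proof -
    \<comment> \<open>The weight divides all dual norms by \<open>w\<close>, so equalities between
      the weighted ones are equalities for \<open>N0\<close>.\<close>
    define w where "w = weight (m, False)"
    have w: "w > 0" by (simp add: w_def weight_pos)
    have X: "dyadic_space (m, False) = B0" "dyadic_norm (m, False) = (\<lambda>x. w * N0 x)"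
      by (auto simp: dyadic_space_def dyadic_norm_def w_def)
    have d: "component F (m, False) \<in> dual s B0 N0" "component G (m, False) \<in> dual s B0 N0"
      using component_dual[OF F(1), of "(m, False)"] component_dual[OF G(1), of "(m, False)"]
      unfolding X dual_scaled[OF w] by auto
    show ?thesis
      using mid[of "(m, False)"] w d n0.dual_midpoint(1)[OF d] unfolding X
      by (intro n0.rotund_dual_eq[OF rot d]) (simp_all add: n0.dual_norm_weighted)
  qed
  then have "f a = g a" if "z \<in> reps a" for z a
    using functional_determined[OF rF rG _ that] by blast
  \<comment> \<open>Outside \<open>quot_space\<close> both functionals are 0 by the encoding of
    \<open>dual\<close>.\<close>
  then have "f a = g a" for a
    using dualD(3)[OF f(1), of a] dualD(3)[OF g(1), of a] by (cases "a \<in> quot_space") (auto simp: quot_space_def)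
  then show False using ne by auto
qed

end

section \<open>Comparison with the real interpolation norm\<close>

lemma sum_ennreal_le_nn_integral_count_space:
  assumes "finite A" "\<And>x. 0 \<le> g x"
  shows "ennreal (sum g A) \<le> (\<integral>\<^sup>+x. ennreal (g x) \<partial>count_space UNIV)"
proof -
  have "ennreal (sum g A) = (\<integral>\<^sup>+x. ennreal (g x) \<partial>count_space A)"
    using assms by (simp add: nn_integral_count_space_finite sum_ennreal)
  also have "\<dots> \<le> (\<integral>\<^sup>+x. ennreal (g x) \<partial>count_space UNIV)"
    by (subst nn_integral_count_space_indicator) (auto intro!: nn_integral_mono simp: indicator_def)
  finally show ?thesis .
qed

lemma nn_integral_count_space_eq_infsum:
  fixes g :: "'a \<Rightarrow> real"
  assumes "g summable_on UNIV" "\<And>x. 0 \<le> g x"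
  shows "(\<integral>\<^sup>+x. ennreal (g x) \<partial>count_space UNIV) = ennreal (infsum g UNIV)"
proof -
  have g: "Infinite_Set_Sum.abs_summable_on g UNIV"
    using assms(1) summable_on_iff_abs_summable_on_real abs_summable_equivalent by blast
  show ?thesis
    using nn_integral_conv_infsetsum[OF g assms(2)] infsetsum_infsum[OF g] by simp
qed

text \<open>The interval with index \<open>m\<close> has length \<open>2 powr m\<close>, so it
  contributes \<open>c m\<close> to the integral. At each \<open>t\<close> at most one summand is
  nonzero; the form as an integral over a counting measure allows the two integrations to be
  exchanged.\<close>

definition dyadic_step :: "(int \<Rightarrow> real) \<Rightarrow> real \<Rightarrow> ennreal" where
  "dyadic_step c t = (\<integral>\<^sup>+m. ennreal (c m / 2 powr real_of_int m) * indicator {2 powr real_of_int m..<2 powr (real_of_int m + 1)} t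
     \<partial>count_space UNIV)"

lemma nn_integral_dyadic_step:
  assumes "\<And>m. 0 \<le> c m"
  shows "(\<integral>\<^sup>+t. dyadic_step c t \<partial>lborel) = (\<integral>\<^sup>+m. ennreal (c m) \<partial>count_space UNIV)"
proof -
  have "(\<integral>\<^sup>+t. dyadic_step c t \<partial>lborel) = (\<integral>\<^sup>+m. (\<integral>\<^sup>+t. ennreal (c m / 2 powr real_of_int m)
      * indicator {2 powr real_of_int m..<2 powr (real_of_int m + 1)} t \<partial>lborel) \<partial>count_space UNIV)"
    unfolding dyadic_step_def by (rule nn_integral_count_space_nn_integral) auto
  also have "\<dots> = (\<integral>\<^sup>+m. ennreal (c m) \<partial>count_space UNIV)"
  proof (rule nn_integral_cong)
    fix m :: int
    have "(\<integral>\<^sup>+t. ennreal (c m / 2 powr real_of_int m) * indicator {2 powr real_of_int m..<2 powr (real_of_int m + 1)} t \<partial>lborel)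
      = ennreal (c m / 2 powr real_of_int m) * ennreal (2 powr (real_of_int m + 1) - 2 powr real_of_int m)"
      by (subst nn_integral_cmult_indicator) auto
    also have "2 powr (real_of_int m + 1) - 2 powr real_of_int m = (2::real) powr real_of_int m"
      by (simp add: powr_add)
    finally show "(\<integral>\<^sup>+t. ennreal (c m / 2 powr real_of_int m)
      * indicator {2 powr real_of_int m..<2 powr (real_of_int m + 1)} t \<partial>lborel) = ennreal (c m)"
      using assms by (simp add: ennreal_mult[symmetric])
  qed
  finally show ?thesis .
qed

lemma dyadic_interval:
  assumes "0 < t"
  obtains m :: int where "2 powr real_of_int m \<le> t" "t < 2 powr (real_of_int m + 1)"
    "\<And>c. dyadic_step c t = ennreal (c m / 2 powr real_of_int m)"
proof -
  have iff: "t \<in> {2 powr real_of_int m..<2 powr (real_of_int m + 1)} \<longleftrightarrow> m = \<lfloor>log 2 t\<rfloor>" for m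
    using assms floor_eq_iff[of "log 2 t" m] by (auto simp: powr_le_iff less_powr_iff)
  let ?m = "\<lfloor>log 2 t\<rfloor>"
  have "dyadic_step c t = (\<integral>\<^sup>+m. ennreal (c m / 2 powr real_of_int m) * indicator {?m} m \<partial>count_space UNIV)" for c
    unfolding dyadic_step_def by (intro nn_integral_cong) (auto simp: indicator_def iff simp del: atLeastLessThan_iff)
  then have "dyadic_step c t = ennreal (c ?m / 2 powr real_of_int ?m)" for c by simp
  then show ?thesis using iff[of ?m] by (intro that[of ?m]) auto
qed

lemma dyadic_step_nonpos:
  assumes "t \<le> 0"
  shows "dyadic_step c t = 0"
proof -
  have "indicator {2 powr real_of_int m..<2 powr (real_of_int m + 1)} t = (0::ennreal)" for m :: int
    using assms less_le_trans[of 0 "2 powr real_of_int m" t] by (auto simp: indicator_def)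
  then show ?thesis by (simp add: dyadic_step_def)
qed

context normed_couple begin

section \<open>Dyadic values of the K-functional\<close>

abbreviation K :: "real \<Rightarrow> 'v \<Rightarrow> real" where
  "K \<equiv> K_functional B0 N0 B1 N1"

definition sum_space :: "'v set" where
  "sum_space = {a. \<exists>x\<in>B0. \<exists>y\<in>B1. a = x + y}"

lemma K_le:
  assumes "x \<in> B0" "y \<in> B1" "0 < t"
  shows "K t (x + y) \<le> N0 x + t * N1 y"
  unfolding K_functional_def
  using assms n0.nD(2) n1.nD(2)
  by (intro cInf_lower bdd_belowI[where m = 0]) auto

lemma K_greatest:
  assumes "a \<in> sum_space" "\<And>x y. x \<in> B0 \<Longrightarrow> y \<in> B1 \<Longrightarrow> a = x + y \<Longrightarrow> c \<le> N0 x + t * N1 y"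
  shows "c \<le> K t a"
  unfolding K_functional_def using assms by (intro cInf_greatest) (auto simp: sum_space_def)

lemma K_approx:
  assumes "a \<in> sum_space" "K t a < c"
  obtains x y where "x \<in> B0" "y \<in> B1" "a = x + y" "N0 x + t * N1 y < c"
  using K_greatest[OF assms(1), of c t] assms(2) by force

lemma K_nonneg: "a \<in> sum_space \<Longrightarrow> 0 < t \<Longrightarrow> 0 \<le> K t a"
  using n0.nD(2) n1.nD(2) by (intro K_greatest) auto

lemma K_mono:
  assumes "a \<in> sum_space" "0 < t" "t \<le> u"
  shows "K t a \<le> K u a"
proof (rule K_greatest[OF assms(1)])
  fix x y assume xy: "x \<in> B0" "y \<in> B1" "a = x + y"
  have "t * N1 y \<le> u * N1 y" using assms n1.nD(2)[OF xy(2)] by (intro mult_right_mono)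
  with K_le[OF xy(1,2) assms(2)] xy(3) show "K t a \<le> N0 x + u * N1 y" by simp
qed

lemma K_double:
  assumes "a \<in> sum_space" "0 < t" "0 < u" "u \<le> 2 * t"
  shows "K u a \<le> 2 * K t a"
proof -
  have "K u a / 2 \<le> K t a"
  proof (rule K_greatest[OF assms(1)])
    fix x y assume xy: "x \<in> B0" "y \<in> B1" "a = x + y"
    have "u * N1 y \<le> 2 * t * N1 y" using assms n1.nD(2)[OF xy(2)] by (intro mult_right_mono)
    with K_le[OF xy(1,2) assms(3)] xy(3) n0.nD(2)[OF xy(1)] show "K u a / 2 \<le> N0 x + t * N1 y" by simp
  qed
  then show ?thesis by simp
qed

definition dyadic_K :: "'v \<Rightarrow> int \<Rightarrow> real" where
  "dyadic_K a m = 2 powr (- \<theta> * real_of_int m) * K (2 powr real_of_int m) a"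

lemma dyadic_K_nonneg: "a \<in> sum_space \<Longrightarrow> 0 \<le> dyadic_K a m"
  using K_nonneg by (simp add: dyadic_K_def)

text \<open>For \<open>t\<close> between \<open>r = 2 powr m\<close> and \<open>2 * r\<close>, each
  of \<open>t powr (-\<theta>)\<close>, \<open>K t a\<close> and \<open>1 / t\<close> agrees with
  its value at \<open>r\<close> up to a factor 2: the first and third decrease by at most half, the
  second at most doubles.\<close>

lemma integrand_bounds:
  assumes a: "a \<in> sum_space" and t: "2 powr real_of_int m \<le> t" "t < 2 powr (real_of_int m + 1)"
  shows "(t powr (-\<theta>) * K t a) powr p / t \<le> 2 powr p * dyadic_K a m powr p / 2 powr real_of_int m"
    and "dyadic_K a m powr p / (2 powr p * 2) / 2 powr real_of_int m \<le> (t powr (-\<theta>) * K t a) powr p / t"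
proof -
  define r where "r = 2 powr real_of_int m"
  have r: "0 < r" "r \<le> t" "t < 2 * r" using t by (auto simp: r_def powr_add)
  have t0: "0 < t" using r by simp
  have d: "dyadic_K a m = r powr (-\<theta>) * K r a" by (simp add: dyadic_K_def r_def powr_powr mult.commute)
  have Kr: "0 \<le> K r a" "0 \<le> K t a" using K_nonneg a r t0 by auto
  have "t powr (-\<theta>) \<le> r powr (-\<theta>)" using r \<theta> by (intro powr_mono2') auto
  moreover have "K t a \<le> 2 * K r a" using K_double[OF a] r t0 by simp
  ultimately have "t powr (-\<theta>) * K t a \<le> 2 * dyadic_K a m"
    unfolding d using Kr by (metis mult.left_commute mult_mono powr_ge_zero)
  then have "(t powr (-\<theta>) * K t a) powr p \<le> (2 * dyadic_K a m) powr p"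
    using Kr p by (intro powr_mono2) auto
  also have "\<dots> = 2 powr p * dyadic_K a m powr p"
    using dyadic_K_nonneg[OF a] by (simp add: powr_mult)
  finally show "(t powr (-\<theta>) * K t a) powr p / t \<le> 2 powr p * dyadic_K a m powr p / 2 powr real_of_int m"
    using r unfolding r_def[symmetric] by (intro frac_le) auto
  have "r powr (-\<theta>) / 2 \<le> (2 * r) powr (-\<theta>)"
  proof -
    have "1 / 2 \<le> (2::real) powr (-\<theta>)" using powr_mono[of "-1" "-\<theta>" "2::real"] \<theta> by (simp add: powr_minus_divide)
    then show ?thesis using r by (simp add: powr_mult)
  qed
  also have "\<dots> \<le> t powr (-\<theta>)" using r \<theta> t0 by (intro powr_mono2') auto
  finally have "dyadic_K a m / 2 \<le> t powr (-\<theta>) * K t a"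
    unfolding d using mult_mono[OF _ K_mono[OF a r(1,2)], of "r powr (-\<theta>) / 2" "t powr (-\<theta>)"] Kr by simp
  then have "(dyadic_K a m / 2) powr p \<le> (t powr (-\<theta>) * K t a) powr p"
    using dyadic_K_nonneg[OF a] p by (intro powr_mono2) auto
  then have "(dyadic_K a m / 2) powr p / (2 * r) \<le> (t powr (-\<theta>) * K t a) powr p / t"
    using r by (intro frac_le) auto
  then show "dyadic_K a m powr p / (2 powr p * 2) / 2 powr real_of_int m \<le> (t powr (-\<theta>) * K t a) powr p / t"
    using dyadic_K_nonneg[OF a] by (simp add: r_def powr_divide)
qed

abbreviation I :: "'v \<Rightarrow> ennreal" where
  "I \<equiv> interp_integral B0 N0 B1 N1 \<theta> p"

lemma interp_integral_le:
  assumes a: "a \<in> sum_space" and sm: "(\<lambda>m. dyadic_K a m powr p) summable_on UNIV"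
  shows "I a \<le> ennreal (2 powr p * (\<Sum>\<^sub>\<infinity>m. dyadic_K a m powr p))"
proof -
  have "I a \<le> (\<integral>\<^sup>+t. dyadic_step (\<lambda>m. 2 powr p * dyadic_K a m powr p) t \<partial>lborel)"
    unfolding interp_integral_def
  proof (rule nn_integral_mono)
    fix t :: real
    show "ennreal ((t powr (-\<theta>) * K t a) powr p / t) * indicator {0<..} t
      \<le> dyadic_step (\<lambda>m. 2 powr p * dyadic_K a m powr p) t"
    proof (cases "0 < t")
      case True
      obtain m where "2 powr real_of_int m \<le> t" "t < 2 powr (real_of_int m + 1)"
        "\<And>c. dyadic_step c t = ennreal (c m / 2 powr real_of_int m)" using dyadic_interval[OF True] by blast
      then show ?thesis using True integrand_bounds(1)[OF a] by (auto intro!: ennreal_leI)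
    qed auto
  qed
  also have "\<dots> = (\<integral>\<^sup>+m. ennreal (2 powr p * dyadic_K a m powr p) \<partial>count_space UNIV)"
    by (rule nn_integral_dyadic_step) auto
  also have "\<dots> = ennreal (\<Sum>\<^sub>\<infinity>m. 2 powr p * dyadic_K a m powr p)"
    by (intro nn_integral_count_space_eq_infsum summable_on_cmult_right sm) auto
  finally show ?thesis by (simp add: infsum_cmult_right')
qed

lemma dyadic_K_sum_le:
  assumes a: "a \<in> sum_space" and fin: "I a < \<infinity>" and A: "finite A"
  shows "(\<Sum>m\<in>A. dyadic_K a m powr p) \<le> 2 powr p * 2 * enn2real (I a)"
proof -
  let ?c = "\<lambda>m. dyadic_K a m powr p / (2 powr p * 2)"
  have "ennreal (sum ?c A) \<le> (\<integral>\<^sup>+m. ennreal (?c m) \<partial>count_space UNIV)"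
    by (rule sum_ennreal_le_nn_integral_count_space[OF A]) auto
  also have "\<dots> = (\<integral>\<^sup>+t. dyadic_step ?c t \<partial>lborel)"
    by (rule nn_integral_dyadic_step[symmetric]) auto
  also have "\<dots> \<le> I a"
    unfolding interp_integral_def
  proof (rule nn_integral_mono)
    fix t :: real
    show "dyadic_step ?c t \<le> ennreal ((t powr (-\<theta>) * K t a) powr p / t) * indicator {0<..} t"
    proof (cases "0 < t")
      case True
      obtain m where "2 powr real_of_int m \<le> t" "t < 2 powr (real_of_int m + 1)"
        "\<And>c. dyadic_step c t = ennreal (c m / 2 powr real_of_int m)" using dyadic_interval[OF True] by blast
      then show ?thesis using True integrand_bounds(2)[OF a] by (auto intro!: ennreal_leI)
    qed (simp add: dyadic_step_nonpos)
  qed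
  finally have "ennreal (sum ?c A) \<le> ennreal (enn2real (I a))" using fin by (simp add: less_top)
  then have "sum ?c A \<le> enn2real (I a)" by (simp add: ennreal_le_iff)
  then show ?thesis by (simp add: sum_divide_distrib[symmetric] divide_le_eq mult.commute)
qed

lemma weight_eq:
  "weight (m, False) = 2 powr (- \<theta> * real_of_int m)"
  "weight (m, True) = 2 powr (- \<theta> * real_of_int m) * 2 powr real_of_int m"
  by (simp_all add: weight_def powr_add[symmetric] algebra_simps)

lemma dyadic_K_le_reps:
  assumes z: "z \<in> reps a"
  shows "dyadic_K a m powr p \<le> 2 powr p * (\<Sum>j\<in>UNIV. dyadic_norm (m, j) (z (m, j)) powr p)"
proof -
  define x y where "x = dyadic_norm (m, False) (z (m, False))" and "y = dyadic_norm (m, True) (z (m, True))"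
  have xy: "0 \<le> x" "0 \<le> y" using lp_spaceD(3)[OF repsD(1)[OF z]] by (auto simp: x_def y_def)
  have a: "a \<in> sum_space" using repsD(2-4)[OF z, of 0] unfolding sum_space_def by blast
  have "dyadic_K a m \<le> 2 powr (- \<theta> * real_of_int m) *
      (N0 (z (m, False)) + 2 powr real_of_int m * N1 (z (m, True)))"
    unfolding dyadic_K_def using K_le[OF repsD(3)[OF z, of m] repsD(4)[OF z, of m], of "2 powr real_of_int m"] repsD(2)[OF z, of m]
    by (intro mult_left_mono) auto
  also have "\<dots> = x + y"
    by (simp add: x_def y_def dyadic_norm_def weight_eq distrib_left mult.assoc)
  \<comment> \<open>Through the maximum, the power of the sum is bounded by \<open>2 powr p\<close>
    times the sum of the powers.\<close>
  also have "\<dots> \<le> 2 * max x y" by simp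
  finally have "dyadic_K a m powr p \<le> (2 * max x y) powr p"
    using dyadic_K_nonneg[OF a] p by (intro powr_mono2) auto
  also have "\<dots> = 2 powr p * max x y powr p" using xy by (simp add: powr_mult)
  also have "\<dots> \<le> 2 powr p * (x powr p + y powr p)"
    by (intro mult_left_mono) (auto simp: max_def)
  finally show ?thesis by (simp add: UNIV_bool x_def y_def)
qed

text \<open>The constant 4 is the p-th root of two factors \<open>2 powr p\<close>, one from
  \<open>interp_integral_le\<close> and one from \<open>dyadic_K_le_reps\<close>.\<close>

lemma interp_norm_le_reps:
  assumes z: "z \<in> reps a"
  shows "a \<in> interp_space B0 N0 B1 N1 \<theta> p" "interp_norm B0 N0 B1 N1 \<theta> p a \<le> 4 * lp_norm z"
proof -
  have a: "a \<in> sum_space" using repsD(2-4)[OF z, of 0] unfolding sum_space_def by blast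
  have fin: "(\<Sum>m\<in>A. dyadic_K a m powr p) \<le> 2 powr p * lp_norm z powr p" if A: "finite A" for A
  proof -
    have "(\<Sum>m\<in>A. dyadic_K a m powr p)
      \<le> (\<Sum>m\<in>A. 2 powr p * (\<Sum>j\<in>UNIV. dyadic_norm (m, j) (z (m, j)) powr p))"
      by (intro sum_mono dyadic_K_le_reps z)
    also have "\<dots> = 2 powr p * (\<Sum>k\<in>A \<times> UNIV. dyadic_norm k (z k) powr p)"
      by (simp add: sum_distrib_left[symmetric] sum.cartesian_product split_def)
    also have "\<dots> \<le> 2 powr p * lp_norm z powr p"
      unfolding lp_norm_powr using lp_spaceD(2)[OF repsD(1)[OF z]] A
      by (intro mult_left_mono finite_sum_le_infsum) auto
    finally show ?thesis .
  qed
  have sm: "(\<lambda>m. dyadic_K a m powr p) summable_on UNIV"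
    using fin by (intro nonneg_bdd_above_summable_on bdd_aboveI2) auto
  have "(\<Sum>\<^sub>\<infinity>m. dyadic_K a m powr p) \<le> 2 powr p * lp_norm z powr p"
    using fin by (intro infsum_le_finite_sums[OF sm]) auto
  then have "I a \<le> ennreal (2 powr p * (2 powr p * lp_norm z powr p))"
    by (intro order_trans[OF interp_integral_le[OF a sm]] ennreal_leI mult_left_mono) auto
  also have "2 powr p * (2 powr p * lp_norm z powr p) = (4 * lp_norm z) powr p"
    using lp_norm_nonneg[of z] by (simp add: powr_mult[symmetric])
  finally have I: "I a \<le> ennreal ((4 * lp_norm z) powr p)" .
  show "a \<in> interp_space B0 N0 B1 N1 \<theta> p"
    using a I le_less_trans[OF I] by (auto simp: interp_space_def sum_space_def)
  have "enn2real (I a) \<le> (4 * lp_norm z) powr p" using I by (simp add: enn2real_leI)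
  then have "interp_norm B0 N0 B1 N1 \<theta> p a \<le> ((4 * lp_norm z) powr p) powr (1 / p)"
    unfolding interp_norm_def using p by (intro powr_mono2) auto
  then show "interp_norm B0 N0 B1 N1 \<theta> p a \<le> 4 * lp_norm z"
    using p lp_norm_nonneg[of z] powr_inverse_cancel(1)[of "4 * lp_norm z" p] by simp
qed

text \<open>At every level a decomposition of \<open>a\<close> within a factor 2 of the infimum is
  chosen. Such a choice exists if \<open>K t a\<close> is positive, and \<open>separated\<close>
  ensures this for \<open>a \<noteq> 0\<close>.\<close>

lemma reps_of_interp_space:
  assumes sep: separated
    and a: "a \<in> interp_space B0 N0 B1 N1 \<theta> p"
  obtains z where "z \<in> reps a" "lp_norm z \<le> 16 * interp_norm B0 N0 B1 N1 \<theta> p a"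
proof (cases "a = 0")
  case True
  then show ?thesis using that[OF reps_zero[folded True]] lp_norm_zero by (simp add: interp_norm_def)
next
  case False
  have S: "a \<in> sum_space" and fin: "I a < \<infinity>" using a by (auto simp: interp_space_def sum_space_def)
  have Kpos: "0 < K t a" if t: "0 < t" for t
  proof (rule ccontr)
    assume neg: "\<not> 0 < K t a"
    have "\<exists>x\<in>B0. \<exists>y\<in>B1. a = x + y \<and> N0 x < e \<and> N1 y < e" if e: "e > 0" for e
    proof -
      \<comment> \<open>The bound \<open>e\<close> controls \<open>N0 x\<close>; the bound
        \<open>t * e\<close> controls \<open>N1 y\<close> after division by
        \<open>t\<close>.\<close>
      have "K t a < min e (t * e)" using neg t e by (auto simp: not_less intro: le_less_trans)
      then obtain x y where xy: "x \<in> B0" "y \<in> B1" "a = x + y" "N0 x + t * N1 y < min e (t * e)"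
        using K_approx[OF S] by blast
      have "0 \<le> N0 x" "0 \<le> t * N1 y" using n0.nD(2)[OF xy(1)] n1.nD(2)[OF xy(2)] t by auto
      then have "N0 x < e" "t * N1 y < t * e" using xy(4) by auto
      then show ?thesis using xy t by auto
    qed
    then show False using separatedD[OF sep, of a] False by blast
  qed
  have "\<exists>x y. x \<in> B0 \<and> y \<in> B1 \<and> a = x + y \<and>
      N0 x + 2 powr real_of_int m * N1 y < 2 * K (2 powr real_of_int m) a" for m :: int
  proof -
    have "K (2 powr real_of_int m) a < 2 * K (2 powr real_of_int m) a"
      using Kpos[of "2 powr real_of_int m"] by simp
    from K_approx[OF S this] show ?thesis by blast
  qed
  then obtain x y where xy: "\<And>m :: int. x m \<in> B0" "\<And>m. y m \<in> B1" "\<And>m. a = x m + y m"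
    "\<And>m. N0 (x m) + 2 powr real_of_int m * N1 (y m) < 2 * K (2 powr real_of_int m) a" by metis
  define z where "z k = (if snd k then y (fst k) else x (fst k))" for k :: "int \<times> bool"
  have X: "z k \<in> dyadic_space k" for k using xy(1,2) by (simp add: z_def dyadic_space_def)
  have le: "dyadic_norm k (z k) powr p \<le> 2 powr p * dyadic_K a (fst k) powr p" for k
  proof -
    obtain m j where k: "k = (m, j)" by fastforce
    define r where "r = 2 powr real_of_int m"
    have "weight (m, True) = 2 powr (- \<theta> * real_of_int m) * r"
      "weight (m, False) = 2 powr (- \<theta> * real_of_int m)"
      by (simp_all add: weight_eq r_def)
    moreover have "0 \<le> N0 (x m)" "0 \<le> r * N1 (y m)"
      using n0.nD(2)[OF xy(1)] n1.nD(2)[OF xy(2)] by (auto simp: r_def)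
    then have "N0 (x m) \<le> 2 * K r a" "r * N1 (y m) \<le> 2 * K r a" using xy(4)[of m] by (auto simp: r_def)
    ultimately have "dyadic_norm k (z k) \<le> 2 powr (- \<theta> * real_of_int m) * (2 * K r a)"
      unfolding k dyadic_norm_def z_def by (cases j) (auto simp: mult.assoc intro!: mult_left_mono)
    then have "dyadic_norm k (z k) \<le> 2 * dyadic_K a m" by (simp add: dyadic_K_def r_def)
    then have "dyadic_norm k (z k) powr p \<le> (2 * dyadic_K a m) powr p"
      using comp.nD(2)[OF X] p by (intro powr_mono2) auto
    then show ?thesis using dyadic_K_nonneg[OF S] by (simp add: powr_mult k)
  qed
  define i where "i = enn2real (I a)"
  have fins: "(\<Sum>k\<in>A. dyadic_norm k (z k) powr p) \<le> 16 powr p * i" if A: "finite A" for A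
  proof -
    \<comment> \<open>The finite set is enlarged to contain both copies at each of its
      levels.\<close>
    have "(\<Sum>k\<in>A. dyadic_norm k (z k) powr p) \<le> (\<Sum>k\<in>fst ` A \<times> UNIV. dyadic_norm k (z k) powr p)"
      using A by (intro sum_mono2) force+
    also have "\<dots> \<le> (\<Sum>k\<in>fst ` A \<times> (UNIV :: bool set). 2 powr p * dyadic_K a (fst k) powr p)"
      by (intro sum_mono le)
    also have "\<dots> = 2 powr p * 2 * (\<Sum>m\<in>fst ` A. dyadic_K a m powr p)"
      by (simp add: sum.cartesian_product' UNIV_bool sum_distrib_left mult.assoc mult.left_commute)
    also have "\<dots> \<le> 2 powr p * 2 * (2 powr p * 2 * i)"
      using dyadic_K_sum_le[OF S fin] A by (intro mult_left_mono) (auto simp: i_def)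
    \<comment> \<open>Each bare factor 2 is enlarged to \<open>2 powr p\<close>, and four such
      factors make \<open>16 powr p\<close>.\<close>
    also have "\<dots> \<le> 2 powr p * 2 powr p * (2 powr p * 2 powr p * i)"
      using powr_mono[of 1 p "2::real"] p by (intro mult_mono mult_nonneg_nonneg order_refl) (auto simp: i_def)
    also have "\<dots> = 16 powr p * i"
      by (simp add: mult.assoc[symmetric] powr_mult[symmetric])
    finally show ?thesis .
  qed
  have sm: "(\<lambda>k. dyadic_norm k (z k) powr p) summable_on UNIV"
    using fins by (intro nonneg_bdd_above_summable_on bdd_aboveI2) auto
  have "z \<in> lp_space" unfolding lp_space_def using X sm by blast
  moreover have "z (m, False) + z (m, True) = a" for m using xy(3)[of m] by (simp add: z_def)
  ultimately have z: "z \<in> reps a" by (simp add: reps_def)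
  have "(16 * interp_norm B0 N0 B1 N1 \<theta> p a) powr p = 16 powr p * i"
    using p by (simp add: interp_norm_def powr_mult i_def powr_inverse_cancel)
  then have "lp_norm z \<le> 16 * interp_norm B0 N0 B1 N1 \<theta> p a"
    using fins by (intro lp_norm_le) (auto simp: interp_norm_def intro: infsum_le_finite_sums[OF sm])
  with z show ?thesis by (rule that)
qed

end

section \<open>The topological couple and the final renorming\<close>

lemma interpolation_coupleD:
  assumes "interpolation_couple s B0 N0 B1 N1"
  shows "vector_space s" "norm_on s B0 N0" "norm_on s B1 N1"
    "continuously_embedded B0 N0" "continuously_embedded B1 N1"
  using assms unfolding interpolation_couple_def complex_tvs_def banach_on_def by - (elim conjE, assumption)+

text \<open>Parts of norm below \<open>1 / (n + 1)\<close> tend to 0 in the ambient space by the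
  continuous embeddings. Their sum is constantly \<open>a\<close>, and limits in a Hausdorff space
  are unique.\<close>

lemma interpolation_couple_small_parts:
  assumes c: "interpolation_couple s B0 N0 B1 N1"
    and small: "\<And>e. e > 0 \<Longrightarrow> \<exists>x\<in>B0. \<exists>y\<in>B1. a = x + y \<and> N0 x < e \<and> N1 y < e"
  shows "a = 0"
proof -
  note vs = interpolation_coupleD(1)[OF c] and n0 = interpolation_coupleD(2)[OF c]
    and n1 = interpolation_coupleD(3)[OF c] and e = interpolation_coupleD(4,5)[OF c]
  interpret n0: complex_normed s B0 N0
    by (rule complex_normed.intro[OF vs complex_normed_axioms.intro[OF n0]])
  interpret n1: complex_normed s B1 N1
    by (rule complex_normed.intro[OF vs complex_normed_axioms.intro[OF n1]])
  have lim: "u \<longlonglongrightarrow> 0"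
    if emb: "continuously_embedded B N" "0 \<in> B" and u: "\<And>n. u n \<in> B" "\<And>n. N (u n) < 1 / (real n + 1)"
    for u :: "nat \<Rightarrow> 'a" and B N
  proof (rule topological_tendstoI)
    fix U :: "'a set" assume U: "open U" "0 \<in> U"
    have "\<exists>d>0. \<forall>y\<in>B. N (y - 0) < d \<longrightarrow> y \<in> U"
      using emb(1)[unfolded continuously_embedded_def, rule_format, OF emb(2) conjI[OF U]] .
    then obtain d where d: "d > 0" "\<And>y. y \<in> B \<Longrightarrow> N (y - 0) < d \<Longrightarrow> y \<in> U"
      by blast
    have "(\<lambda>n. 1 / (real n + 1)) \<longlonglongrightarrow> 0" using LIMSEQ_inverse_real_of_nat by (simp add: inverse_eq_divide add.commute)
    then have "\<forall>\<^sub>F n in sequentially. 1 / (real n + 1) < d" using d(1) by (rule order_tendstoD(2))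
    then show "\<forall>\<^sub>F n in sequentially. u n \<in> U"
    proof eventually_elim
      case (elim n)
      then show ?case using d(2)[OF u(1)[of n]] u(2)[of n] by simp
    qed
  qed
  have "\<exists>x y. x \<in> B0 \<and> y \<in> B1 \<and> a = x + y \<and> N0 x < 1 / (real n + 1) \<and> N1 y < 1 / (real n + 1)" for n
    using small[of "1 / (real n + 1)"] by fastforce
  then obtain x y where xy: "\<And>n. x n \<in> B0" "\<And>n. y n \<in> B1" "\<And>n. a = x n + y n"
    "\<And>n. N0 (x n) < 1 / (real n + 1)" "\<And>n. N1 (y n) < 1 / (real n + 1)" by metis
  have "(\<lambda>n. x n + y n) \<longlonglongrightarrow> 0 + 0"
    by (intro tendsto_add lim[OF e(1) n0.cl(1) xy(1,4)] lim[OF e(2) n1.cl(1) xy(2,5)])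
  then have "(\<lambda>n. a) \<longlonglongrightarrow> 0" using xy(3) by simp
  then show ?thesis by (simp add: LIMSEQ_const_iff)
qed

text \<open>Used in both directions, it shows that equivalent norms have the same set of bounded
  functionals.\<close>

lemma dual_mono:
  assumes "\<And>x. x \<in> X \<Longrightarrow> 0 \<le> M x" "\<And>x. x \<in> X \<Longrightarrow> M x \<le> b * M' x"
  shows "dual s X M \<subseteq> dual s X M'"
proof
  fix f assume f: "f \<in> dual s X M"
  then obtain D where D: "\<And>x. x \<in> X \<Longrightarrow> cmod (f x) \<le> D * M x" using dualD(4) by blast
  have "cmod (f x) \<le> (\<bar>D\<bar> * b) * M' x" if x: "x \<in> X" for x
  proof -
    have "D * M x \<le> \<bar>D\<bar> * M x" using assms(1)[OF x] by (intro mult_right_mono) auto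
    also have "\<dots> \<le> \<bar>D\<bar> * (b * M' x)" using assms(2)[OF x] by (intro mult_left_mono) auto
    finally show ?thesis using D[OF x] by (simp add: mult.assoc)
  qed
  then have "\<exists>C. \<forall>x\<in>X. cmod (f x) \<le> C * M' x" by blast
  then show "f \<in> dual s X M'" using f unfolding dual_def by simp
qed

theorem corollary7p2:
  fixes s :: "complex \<Rightarrow> 'v \<Rightarrow> 'v::{topological_ab_group_add, t2_space}"
    and B0 B1 :: "'v set" and N0 N1 :: "'v \<Rightarrow> real" and \<theta> p :: real
  assumes "interpolation_couple s B0 N0 B1 N1"
    and "0 < \<theta>" and "\<theta> < 1" and "1 < p"
    and "rotund scale_fun (dual s B0 N0) (dual_norm B0 N0)"
  defines "B \<equiv> interp_space B0 N0 B1 N1 \<theta> p"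
    and "N \<equiv> interp_norm B0 N0 B1 N1 \<theta> p"
  shows "\<exists>M. equivalent_dual_norm s B N M \<and> rotund scale_fun (dual s B N) M"
proof -
  note ic = interpolation_coupleD[OF assms(1)]
  interpret normed_couple s B0 B1 N0 N1 \<theta> p
    by (rule normed_couple.intro[OF ic(1) normed_couple_axioms.intro[OF ic(2,3) assms(2-4)]])
  have sep: separated
    unfolding separated_def using interpolation_couple_small_parts[OF assms(1)] by blast
  note nrm = norm_on_quot[OF sep]
  \<comment> \<open>Exact equality of the sets matters, since elements of \<open>dual\<close> vanish
    outside the space.\<close>
  have B: "B = quot_space"
  proof (intro set_eqI iffI)
    fix a assume "a \<in> B"
    then obtain z where "z \<in> reps a" using reps_of_interp_space[OF sep] unfolding B_def by blast
    then show "a \<in> quot_space" by (auto simp: quot_space_def)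
  next
    fix a assume "a \<in> quot_space"
    then show "a \<in> B" using interp_norm_le_reps(1) by (auto simp: quot_space_def B_def)
  qed
  have upper: "quot_norm a \<le> 16 * N a" if a: "a \<in> B" for a
  proof -
    obtain z where z: "z \<in> reps a" "lp_norm z \<le> 16 * N a"
      using reps_of_interp_space[OF sep] a unfolding B_def N_def by blast
    show ?thesis using quot_norm_le[OF z(1)] z(2) by simp
  qed
  have lower: "1 / 4 * N a \<le> quot_norm a" if "a \<in> B" for a
  proof (rule quot_norm_greatest)
    show "1 / 4 * N a \<le> lp_norm z" if "z \<in> reps a" for z
      using interp_norm_le_reps(2)[OF that] unfolding N_def by simp
  qed (use that B in simp)
  have nonneg: "0 \<le> N a" for a by (simp add: N_def interp_norm_def)
  have "dual s B N \<subseteq> dual s B quot_norm"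
    using lower nonneg by (intro dual_mono[where b = 4]) (auto simp: mult.commute)
  moreover have "dual s B quot_norm \<subseteq> dual s B N"
    using upper quot_norm_nonneg by (intro dual_mono[where b = 16]) (auto simp: B)
  ultimately have dual: "dual s B N = dual s quot_space quot_norm" unfolding B by blast
  have "equivalent_norm s B N quot_norm"
    unfolding equivalent_norm_def using nrm upper lower B
    by (intro conjI exI[of _ "1 / 4 :: real"] exI[of _ "16 :: real"]) auto
  \<comment> \<open>The required norm on the dual is the dual norm of \<open>quot_norm\<close>,
    which is equivalent to \<open>N\<close> with the constants 1/4 and 16.\<close>
  then have "equivalent_dual_norm s B N (dual_norm quot_space quot_norm)"
    unfolding equivalent_dual_norm_def B by blast
  moreover have "rotund scale_fun (dual s B N) (dual_norm quot_space quot_norm)"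
    unfolding dual by (rule rotund_quot_dual[OF nrm assms(5)])
  ultimately show ?thesis by blast
qed

end
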